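(* Let $n\ge 1$. Every Clifford gate $V\in\mathcal{C}_4^{\otimes n}$ on $n$ four-level qudits is, up to a global phase (a complex scalar of modulus $1$), equal to a finite product of the following gates: $S_i$, $T_i$, $Z_i$ for $i\in\{1,\dots,n\}$, and the nearest-neighbor controlled gates $C_{Z(i,i+1)}$ for $i\in\{1,\dots,n-1\}$.
   Context: Set $\omega=i=\sqrt{-1}$ (the imaginary unit; $d=4$), $\sqrt{i}=\omega^{1/2}=e^{i\pi/4}$. On $\mathbb{C}^4$ with orthonormal basis $|0\rangle,|1\rangle,|2\rangle,|3\rangle$ (labels in $\mathbb{Z}_4$), the generalized Pauli operators are $X|j\rangle=|j+1 \bmod 4\rangle$ and $Z|j\rangle=\omega^j|j\rangle$, so $X^4=Z^4=1$ and $ZX=\omega XZ$. Define the single-qudit unitaries $$S=\sum_{j=0}^3\omega^{j^2/2}|j\rangle\langle j|,\qquad T=\frac12\begin{pmatrix}\sqrt{i}&1&-\sqrt{i}&1\\1&\sqrt{i}&1&-\sqrt{i}\\-\sqrt{i}&1&\sqrt{i}&1\\1&-\sqrt{i}&1&\sqrt{i}\end{pmatrix},$$ where $\omega^{j^2/2}=e^{i\pi j^2/4}$, and the two-qudit gate $C_Z=\sum_{j,k=0}^3\omega^{jk}|j\rangle\langle j|\otimes|k\rangle\langle k|$. For a single-qudit operator $A$, $A_i$ denotes $A$ acting on the $i$-th tensor factor of $(\mathbb{C}^4)^{\otimes n}$ and as the identity elsewhere; $C_{Z(i,k)}$ denotes $C_Z$ acting on factors $i$ and $k$. The Pauli group $\mathcal{P}_4^{\otimes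 n}$ is the group generated by all $X_i,Z_i$ ($1\le i\le n$) and the scalar $\omega^{1/2}$; the Clifford group $\mathcal{C}_4^{\otimes n}$ is the normalizer of $\mathcal{P}_4^{\otimes n}$ in the unitary group of $(\mathbb{C}^4)^{\otimes n}$, i.e. the unitaries mapping, under conjugation, products of generalized Pauli operators to scalar multiples (by phases) of such products. *)

theory Defs
  imports "Jordan_Normal_Form.Schur_Decomposition" "HOL-Algebra.Group_Action"
    "HOL-Algebra.Generated_Groups"
begin

definition unitary_group :: "nat \<Rightarrow> complex mat monoid" where
  "unitary_group N =
     \<lparr>carrier = {U \<in> carrier_mat N N. U * mat_adjoint U = 1\<^sub>m N \<and> mat_adjoint U * U = 1\<^sub>m N},
      monoid.mult = (*), one = 1\<^sub>m N\<rparr>"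

lemma dim_mat_adjoint [simp]:
  "dim_row (mat_adjoint A) = dim_col A" "dim_col (mat_adjoint A) = dim_row A"
  by (auto simp: mat_adjoint_def)

lemma index_mat_adjoint:
  "i < dim_col A \<Longrightarrow> j < dim_row A \<Longrightarrow> mat_adjoint A $$ (i, j) = conjugate (A $$ (j, i))"
  by (auto simp: mat_adjoint_def mat_of_rows_def)

lemma mat_adjoint_carrier: "A \<in> carrier_mat n m \<Longrightarrow> mat_adjoint A \<in> carrier_mat m n"
  by auto

lemma mat_adjoint_adjoint: "mat_adjoint (mat_adjoint A) = (A :: complex mat)"
  by (rule eq_matI) (auto simp: index_mat_adjoint)

lemma mat_adjoint_mult:
  fixes A B :: "complex mat"
  assumes "A \<in> carrier_mat n m" "B \<in> carrier_mat m k"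
  shows "mat_adjoint (A * B) = mat_adjoint B * mat_adjoint A"
  using assms
  by (intro eq_matI)
     (auto simp: index_mat_adjoint scalar_prod_def conjugate_dist_mul mult.commute intro!: sum.cong)

lemma mat_adjoint_one: "mat_adjoint (1\<^sub>m n) = (1\<^sub>m n :: complex mat)"
  by (rule eq_matI) (auto simp: index_mat_adjoint)

lemma group_unitary_group: "group (unitary_group N)"
proof (rule groupI)
  fix U V assume U: "U \<in> carrier (unitary_group N)" and V: "V \<in> carrier (unitary_group N)"
  have c: "U \<in> carrier_mat N N" "V \<in> carrier_mat N N"
    "mat_adjoint U \<in> carrier_mat N N" "mat_adjoint V \<in> carrier_mat N N"
    using U V by (auto simp: unitary_group_def)
  have adj: "mat_adjoint (U * V) = mat_adjoint V * mat_adjoint U"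
    by (rule mat_adjoint_mult[OF c(1,2)])
  have "(U * V) * (mat_adjoint V * mat_adjoint U) = U * (V * mat_adjoint V) * mat_adjoint U"
    using c by (simp add: assoc_mult_mat[of _ N N _ N _ N])
  moreover have "(mat_adjoint V * mat_adjoint U) * (U * V) = mat_adjoint V * (mat_adjoint U * U) * V"
    using c by (simp add: assoc_mult_mat[of _ N N _ N _ N])
  ultimately show "U \<otimes>\<^bsub>unitary_group N\<^esub> V \<in> carrier (unitary_group N)"
    using U V c adj by (simp add: unitary_group_def)
next
  fix U assume U: "U \<in> carrier (unitary_group N)"
  show "\<exists>V\<in>carrier (unitary_group N). V \<otimes>\<^bsub>unitary_group N\<^esub> U = \<one>\<^bsub>unitary_group N\<^esub>"
    by (rule bexI[of _ "mat_adjoint U"])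
       (use U in \<open>auto simp: unitary_group_def mat_adjoint_adjoint\<close>)
qed (auto simp: unitary_group_def mat_adjoint_one assoc_mult_mat[of _ N N _ N _ N])

text \<open>Kronecker product: the basis vector \<open>|j\<rangle> \<otimes> |k\<rangle>\<close> has index \<open>j * D + k\<close>,
  where \<open>D\<close> is the dimension of the second factor.\<close>

definition kron :: "complex mat \<Rightarrow> complex mat \<Rightarrow> complex mat" (infixl "\<otimes>\<^sub>K" 70) where
  "A \<otimes>\<^sub>K B = mat (dim_row A * dim_row B) (dim_col A * dim_col B)
     (\<lambda>(r, c). A $$ (r div dim_row B, c div dim_col B) * B $$ (r mod dim_row B, c mod dim_col B))"

text \<open>The factors of \<open>(\<complex>\<^sup>4)\<^sup>\<otimes>\<^sup>n\<close> are numbered from \<open>1\<close> to \<open>n\<close>: \<open>on_factor\<close> is meant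
  for \<open>1 \<le> i \<le> n\<close>, and \<open>on_factors_from\<close>, placing a two-qudit operator on the factors
  \<open>i\<close> and \<open>i + 1\<close>, for \<open>1 \<le> i \<le> n - 1\<close>.\<close>

definition on_factor :: "nat \<Rightarrow> nat \<Rightarrow> complex mat \<Rightarrow> complex mat" where
  "on_factor n i A = 1\<^sub>m (4 ^ (i - 1)) \<otimes>\<^sub>K A \<otimes>\<^sub>K 1\<^sub>m (4 ^ (n - i))"

definition on_factors_from :: "nat \<Rightarrow> nat \<Rightarrow> complex mat \<Rightarrow> complex mat" where
  "on_factors_from n i B = 1\<^sub>m (4 ^ (i - 1)) \<otimes>\<^sub>K B \<otimes>\<^sub>K 1\<^sub>m (4 ^ (n - (i + 1)))"

abbreviation sqrt_i :: complex where
  "sqrt_i \<equiv> cis (pi / 4)"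

definition X_gate :: "complex mat" where
  "X_gate = mat 4 4 (\<lambda>(r, c). if r = (c + 1) mod 4 then 1 else 0)"

definition Z_gate :: "complex mat" where
  "Z_gate = mat 4 4 (\<lambda>(r, c). if r = c then \<i> ^ r else 0)"

definition S_gate :: "complex mat" where
  "S_gate = mat 4 4 (\<lambda>(r, c). if r = c then cis (pi * real (r ^ 2) / 4) else 0)"

definition T_gate :: "complex mat" where
  "T_gate = (1 / 2) \<cdot>\<^sub>m mat_of_rows_list 4
     [[  sqrt_i,       1, - sqrt_i,       1],
      [       1,  sqrt_i,        1, - sqrt_i],
      [- sqrt_i,       1,   sqrt_i,       1],
      [       1, - sqrt_i,       1,  sqrt_i]]"

text \<open>The diagonal entry at \<open>|j\<rangle> \<otimes> |k\<rangle>\<close>, which has index \<open>r = 4 * j + k\<close>,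
  is \<open>\<i> ^ (j * k)\<close>.\<close>

definition CZ_gate :: "complex mat" where
  "CZ_gate = mat 16 16 (\<lambda>(r, c). if r = c then \<i> ^ ((r div 4) * (r mod 4)) else 0)"

definition pauli_group :: "nat \<Rightarrow> complex mat set" where
  "pauli_group n = generate (unitary_group (4 ^ n))
     ((\<lambda>i. on_factor n i X_gate) ` {1..n} \<union> (\<lambda>i. on_factor n i Z_gate) ` {1..n}
       \<union> {sqrt_i \<cdot>\<^sub>m 1\<^sub>m (4 ^ n)})"

definition clifford_group :: "nat \<Rightarrow> complex mat set" where
  "clifford_group n = normalizer (unitary_group (4 ^ n)) (pauli_group n)"

definition elementary_gates :: "nat \<Rightarrow> complex mat set" where
  "elementary_gates n =
     (\<lambda>i. on_factor n i S_gate) ` {1..n} \<union> (\<lambda>i. on_factor n i T_gate) ` {1..n}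
     \<union> (\<lambda>i. on_factor n i Z_gate) ` {1..n}
     \<union> (\<lambda>i. on_factors_from n i CZ_gate) ` {1..n - 1}"

end

theory Submission
  imports Defs "HOL-Library.Numeral_Type" "HOL-Library.Product_Plus"
begin

text \<open>Up to phase, Pauli operators are vectors over \<open>\<int>/4\<close>, and conjugation by a Clifford operator preserves
  their symplectic form. The gates \<open>S\<close>, \<open>T\<close> act on one factor as the elementary matrices of \<open>SL\<^sub>2(\<int>/4)\<close>.
  Starting from \<open>U = V\<^sup>-\<^sup>1\<close>, multiply on the left by gates so that the factors get fixed one after the
  other: the image of \<open>Z\<^sub>k\<close> is swept from the last factor to factor \<open>k\<close> by clearing neighbouring pairs
  (\<open>\<int>/4\<close> is a chain ring), where the symplectic form with the image of \<open>X\<^sub>k\<close> forces it to be \<open>Z\<^sub>k\<close>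
  after normalization; then the image of \<open>X\<^sub>k\<close> is cleared by gates fixing \<open>Z\<^sub>k\<close>. The operator reached
  commutes up to phase with all \<open>X\<^sub>j\<close>, \<open>Z\<^sub>j\<close>, hence is a Pauli operator up to phase because the Pauli
  operators have trivial commutant. Working with \<open>V\<^sup>-\<^sup>1\<close> expresses \<open>V\<close> by gates without inverting any.\<close>

section \<open>Integers modulo 4 and phases\<close>

text \<open>Since 2 is a zero divisor, images cannot be scaled as over a field: one factor alone has
  the orbit representatives \<open>(0, 0)\<close>, \<open>(0, 1)\<close> and \<open>(0, 2)\<close>,
  and clearing by itself cannot tell them apart. Inverse gates are avoidable because the gates act
  additively on exponents modulo 4, so the third power of a gate already acts as its inverse.
  \<open>X\<close> is no gate, but \<open>T Z T^7\<close> is \<open>X^3 Z\<close> up to phase. The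
  delicate point at the end is the phases. Fixing each \<open>X_j\<close> and \<open>Z_j\<close> up
  to phase allows a priori any scalar of modulus 1, whereas moving a Pauli operator past another
  yields only powers of \<open>\<i>\<close>. The relations \<open>X^4 = Z^4 = 1\<close> close this
  gap, so that a Pauli correction cancels all phases at once.\<close>

type_synonym z4 = 4

lemma z4_exhaust: "x = 0 \<or> x = 1 \<or> x = 2 \<or> x = 3" for x :: z4
proof (cases x)
  case (of_int z)
  then have "z = 0 \<or> z = 1 \<or> z = 2 \<or> z = 3" by auto
  then show ?thesis using of_int by auto
qed

lemma z4_cases [case_names 0 1 2 3]:
  "(x = 0 \<Longrightarrow> P) \<Longrightarrow> (x = 1 \<Longrightarrow> P) \<Longrightarrow> (x = 2 \<Longrightarrow> P) \<Longrightarrow> (x = 3 \<Longrightarrow> P) \<Longrightarrow> P" for x :: z4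
  using z4_exhaust[of x] by blast

text \<open>The last two binary digits decide a numeral modulo 4. As rewrite rules these reduce
  every constant to \<open>0\<close>, \<open>1\<close>, \<open>2\<close> or \<open>3\<close>, so
  that identities over \<open>z4\<close> follow by cases and simplification.\<close>

lemma z4_numeral [simp]:
  "numeral (num.Bit0 (num.Bit0 w)) = (0 :: z4)" "numeral (num.Bit1 (num.Bit0 w)) = (1 :: z4)"
  "numeral (num.Bit0 (num.Bit1 w)) = (2 :: z4)" "numeral (num.Bit1 (num.Bit1 w)) = (3 :: z4)"
  "- 1 = (3 :: z4)" "- 2 = (2 :: z4)" "- 3 = (1 :: z4)"
  by (simp_all add: bit0.Rep_inject_sym bit0.Rep_numeral bit0.Rep_0 bit0.Rep_1 uminus_bit0_def Abs_bit0'_code)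

lemma Rep_of_nat_z4: "Rep_bit0 (of_nat r :: z4) = int r" if "r < 4"
  using that by (simp add: bit0.of_nat_eq bit0.Abs_inverse)

lemma of_nat_z4_eq_iff: "of_nat r = (of_nat c :: z4) \<longleftrightarrow> r = c" if "r < 4" "c < 4"
  using that by (simp add: bit0.Rep_inject_sym Rep_of_nat_z4)

definition ipow :: "z4 \<Rightarrow> complex" where
  "ipow x = \<i> ^ nat (Rep_bit0 x)"

lemma ipow_simps [simp]: "ipow 0 = 1" "ipow 1 = \<i>" "ipow 2 = -1" "ipow 3 = -\<i>"
  by (simp_all add: ipow_def bit0.Rep_0 bit0.Rep_1 bit0.Rep_numeral eval_nat_numeral)

lemma ipow_add: "ipow (x + y) = ipow x * ipow y"
  by (cases x rule: z4_cases; cases y rule: z4_cases) simp_all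

lemma ipow_of_nat: "ipow (of_nat k) = \<i> ^ k"
  by (induction k) (simp_all add: ipow_add)

lemma norm_ipow [simp]: "cmod (ipow x) = 1"
  by (cases x rule: z4_cases) simp_all

text \<open>Lets elements of Z/4 be read off from phases: this recovers the symplectic form from
  commutation factors and separates the eigenvalues of \<open>Z\<close>.\<close>

lemma ipow_inj: "ipow x = ipow y \<longleftrightarrow> x = y"
  by (cases x rule: z4_cases; cases y rule: z4_cases) (simp_all add: complex_eq_iff)

lemma ipow_surj: "\<exists>x. c = ipow x" if "c ^ 4 = 1"
proof -
  have "(c - 1) * (c + 1) * (c - \<i>) * (c + \<i>) = c ^ 4 - 1"
    by (simp add: algebra_simps eval_nat_numeral)
  then have "c = 1 \<or> c = -1 \<or> c = \<i> \<or> c = -\<i>"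
    using that by (auto simp: eq_neg_iff_add_eq_0)
  then show ?thesis by (metis ipow_simps)
qed

section \<open>Quadratic phases on Z/4\<close>

definition s_phase :: "z4 \<Rightarrow> complex" where
  "s_phase x = cis (pi * real ((nat (Rep_bit0 x)) ^ 2) / 4)"

lemma s_phase_simps [simp]:
  "s_phase 0 = 1" "s_phase 1 = sqrt_i" "s_phase 2 = -1" "s_phase 3 = sqrt_i"
proof -
  have "s_phase 3 = cis (pi / 4 + 2 * pi)"
    unfolding s_phase_def by (rule arg_cong[of _ _ cis]) (simp add: bit0.Rep_numeral)
  also have "\<dots> = sqrt_i" by (simp only: cis_mult[symmetric] cis_2pi mult_1_right)
  finally show "s_phase 3 = sqrt_i" .
qed (simp_all add: s_phase_def bit0.Rep_0 bit0.Rep_1 bit0.Rep_numeral)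

lemma sqrt_i_square: "sqrt_i * sqrt_i = \<i>"
  by (simp add: cis_mult)

lemma sqrt_i_cnj: "sqrt_i * cnj sqrt_i = 1"
  by (simp add: cis_cnj cis_mult)

lemma norm_s_phase [simp]: "cmod (s_phase x) = 1"
  by (cases x rule: z4_cases) simp_all

text \<open>The exponent of \<open>\<i>\<close> is \<open>x^2 / 2\<close>, and
  \<open>(x + y)^2 / 2\<close> exceeds \<open>x^2 / 2 + y^2 / 2\<close> by \<open>x * y\<close>.
  Shifting \<open>x\<close> by 4 changes the exponent by \<open>4 * x + 8\<close>, so the phase is
  well defined modulo 4.\<close>

lemma s_phase_add: "s_phase (x + y) = s_phase x * s_phase y * ipow (x * y)"
  by (cases x rule: z4_cases; cases y rule: z4_cases) (simp_all add: cis_mult)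

lemma s_phase_of_nat: "s_phase (of_nat r) = cis (pi * real (r ^ 2) / 4)" if "r < 4"
  using that by (simp add: s_phase_def Rep_of_nat_z4)

section \<open>Kronecker products\<close>

lemma dim_kron [simp]:
  "dim_row (A \<otimes>\<^sub>K B) = dim_row A * dim_row B" "dim_col (A \<otimes>\<^sub>K B) = dim_col A * dim_col B"
  by (simp_all add: kron_def)

lemma kron_carrier [intro]:
  "A \<in> carrier_mat a b \<Longrightarrow> B \<in> carrier_mat c d \<Longrightarrow> A \<otimes>\<^sub>K B \<in> carrier_mat (a * c) (b * d)"
  by auto

lemma index_kron:
  "r < dim_row A * dim_row B \<Longrightarrow> c < dim_col A * dim_col B \<Longrightarrow>
     (A \<otimes>\<^sub>K B) $$ (r, c) =
       A $$ (r div dim_row B, c div dim_col B) * B $$ (r mod dim_row B, c mod dim_col B)"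
  by (simp add: kron_def)

lemma div_mod_less_mult: "r div b < a" "r mod b < b" if "r < a * b" for r a b :: nat
proof -
  from that have "b > 0" by (cases b) auto
  with that show "r div b < a" "r mod b < b" by (auto simp: less_mult_imp_div_less)
qed

lemma mult_add_less_mult: "i * b + j < a * b" if "i < a" "j < b" for i j a b :: nat
proof -
  have "i * b + j < Suc i * b" using that by simp
  also have "\<dots> \<le> a * b" using that by (intro mult_right_mono) auto
  finally show ?thesis .
qed

lemma sum_div_mod:
  fixes f g :: "nat \<Rightarrow> complex"
  shows "(\<Sum>k<b * e. f (k div e) * g (k mod e)) = (\<Sum>i<b. f i) * (\<Sum>j<e. g j)"
proof -
  have "(\<Sum>k<b * e. f (k div e) * g (k mod e)) = (\<Sum>(i, j)\<in>{..<b} \<times> {..<e}. f i * g j)"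
    by (rule sum.reindex_bij_witness[of _ "\<lambda>(i, j). i * e + j" "\<lambda>k. (k div e, k mod e)"])
       (auto simp: div_mod_less_mult mult_add_less_mult)
  then show ?thesis by (simp add: sum_product sum.cartesian_product)
qed

lemma kron_mult:
  assumes "A \<in> carrier_mat a b" "C \<in> carrier_mat b c" "B \<in> carrier_mat d e" "E \<in> carrier_mat e f"
  shows "(A \<otimes>\<^sub>K B) * (C \<otimes>\<^sub>K E) = (A * C) \<otimes>\<^sub>K (B * E)"
proof (rule eq_matI)
  fix r s assume "r < dim_row ((A * C) \<otimes>\<^sub>K (B * E))" "s < dim_col ((A * C) \<otimes>\<^sub>K (B * E))"
  then have r: "r < a * d" and s: "s < c * f" using assms by auto
  note rs = div_mod_less_mult[OF r] div_mod_less_mult[OF s]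
  have "((A \<otimes>\<^sub>K B) * (C \<otimes>\<^sub>K E)) $$ (r, s) =
      (\<Sum>k<b * e. (A $$ (r div d, k div e) * C $$ (k div e, s div f)) *
        (B $$ (r mod d, k mod e) * E $$ (k mod e, s mod f)))"
    using assms r s
    by (auto simp: scalar_prod_def index_kron atLeast0LessThan intro!: sum.cong)
  also have "\<dots> = ((A * C) \<otimes>\<^sub>K (B * E)) $$ (r, s)"
    using assms r s rs
    by (subst sum_div_mod) (simp add: index_kron scalar_prod_def atLeast0LessThan)
  finally show "((A \<otimes>\<^sub>K B) * (C \<otimes>\<^sub>K E)) $$ (r, s) = ((A * C) \<otimes>\<^sub>K (B * E)) $$ (r, s)" .
qed (use assms in auto)

lemma kron_assoc: "(A \<otimes>\<^sub>K B) \<otimes>\<^sub>K C = A \<otimes>\<^sub>K (B \<otimes>\<^sub>K C)"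
proof (rule eq_matI)
  fix r s assume "r < dim_row (A \<otimes>\<^sub>K (B \<otimes>\<^sub>K C))" "s < dim_col (A \<otimes>\<^sub>K (B \<otimes>\<^sub>K C))"
  then have r: "r < dim_row A * dim_row B * dim_row C" and s: "s < dim_col A * dim_col B * dim_col C"
    by (auto simp: algebra_simps)
  have r': "r < dim_row A * (dim_row B * dim_row C)" and s': "s < dim_col A * (dim_col B * dim_col C)"
    using r s by (simp_all add: mult.assoc)
  have m: "x mod (b * c) div c = x div c mod b" "x mod (b * c) mod c = x mod c"
    "x div c div b = x div (b * c)" for x b c :: nat
    by (cases "c = 0"; simp add: mult.commute[of b] mod_mult2_eq div_mult2_eq)+
  show "((A \<otimes>\<^sub>K B) \<otimes>\<^sub>K C) $$ (r, s) = (A \<otimes>\<^sub>K (B \<otimes>\<^sub>K C)) $$ (r, s)"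
    using r s r' s' div_mod_less_mult[OF r] div_mod_less_mult[OF s]
      div_mod_less_mult[OF r'] div_mod_less_mult[OF s']
    by (simp add: index_kron m)
qed (auto simp: algebra_simps)

lemma kron_one_one [simp]: "1\<^sub>m a \<otimes>\<^sub>K 1\<^sub>m b = 1\<^sub>m (a * b)"
proof (rule eq_matI)
  fix r s assume "r < dim_row (1\<^sub>m (a * b))" "s < dim_col (1\<^sub>m (a * b))"
  then have r: "r < a * b" and s: "s < a * b" by auto
  show "(1\<^sub>m a \<otimes>\<^sub>K 1\<^sub>m b) $$ (r, s) = 1\<^sub>m (a * b) $$ (r, s)"
    using r s div_mod_less_mult[OF r] div_mod_less_mult[OF s]
    by (auto simp: index_kron) (metis div_mult_mod_eq)
qed auto

lemma kron_one_right [simp]: "A \<otimes>\<^sub>K 1\<^sub>m 1 = A"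
  by (rule eq_matI) (auto simp: index_kron)

lemma kron_smult:
  "(c \<cdot>\<^sub>m A) \<otimes>\<^sub>K B = c \<cdot>\<^sub>m (A \<otimes>\<^sub>K B)" "A \<otimes>\<^sub>K (c \<cdot>\<^sub>m B) = c \<cdot>\<^sub>m (A \<otimes>\<^sub>K B)"
  by (rule eq_matI; auto simp: index_kron div_mod_less_mult)+

lemma mat_adjoint_kron: "mat_adjoint (A \<otimes>\<^sub>K B) = mat_adjoint A \<otimes>\<^sub>K mat_adjoint B"
  by (rule eq_matI) (auto simp: index_kron index_mat_adjoint div_mod_less_mult conjugate_dist_mul)

text \<open>The entries of \<open>A\<close> reappear in the rows and columns divisible by
  \<open>d\<close>. This transfers commutation from \<open>n + 1\<close> factors to the first
  \<open>n\<close>.\<close>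

lemma kron_one_cancel: "A = B"
  if "A \<otimes>\<^sub>K 1\<^sub>m d = B \<otimes>\<^sub>K 1\<^sub>m d" "d > 0" "A \<in> carrier_mat a b" "B \<in> carrier_mat a b"
proof (rule eq_matI)
  fix r s assume rs: "r < dim_row B" "s < dim_col B"
  with that(2-) arg_cong[OF that(1), of "\<lambda>M. M $$ (r * d, s * d)"]
  show "A $$ (r, s) = B $$ (r, s)" by (simp add: index_kron)
qed (use that in auto)

section \<open>Single-qudit operators\<close>

lemma sum_z4: "(\<Sum>x::z4\<in>UNIV. f x) = f 0 + f 1 + f 2 + f 3" for f :: "z4 \<Rightarrow> complex"
proof -
  have "(UNIV :: z4 set) = {0, 1, 2, 3}" using z4_exhaust by auto
  then have "sum f UNIV = sum f {0, 1, 2, 3}" by (rule arg_cong)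
  also have "\<dots> = f 0 + f 1 + f 2 + f 3" by (simp add: add.assoc)
  finally show ?thesis .
qed

lemma sum_of_nat_z4: "(\<Sum>k<4. f (of_nat k)) = (\<Sum>x::z4\<in>UNIV. f x)" for f :: "z4 \<Rightarrow> complex"
  by (simp add: sum_z4 eval_nat_numeral add.assoc)

text \<open>\<open>pauli1 (a, b)\<close> is \<open>X\<^sup>a Z\<^sup>b\<close>.\<close>

definition pauli1 :: "z4 \<times> z4 \<Rightarrow> complex mat" where
  "pauli1 p = mat 4 4 (\<lambda>(r, c). if of_nat r = of_nat c + fst p then ipow (snd p * of_nat c) else 0)"

lemma pauli1_carrier [simp]: "pauli1 p \<in> carrier_mat 4 4" "dim_row (pauli1 p) = 4" "dim_col (pauli1 p) = 4"
  by (auto simp: pauli1_def)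

lemma pauli1_0: "pauli1 0 = 1\<^sub>m 4"
  by (rule eq_matI) (auto simp: pauli1_def of_nat_z4_eq_iff)

lemma pauli1_X: "pauli1 (1, 0) = X_gate"
proof (rule eq_matI)
  fix r c assume "r < dim_row X_gate" "c < dim_col X_gate"
  then have rc: "r < 4" "c < 4" by (auto simp: X_gate_def)
  have "(of_nat c + 1 :: z4) = of_nat ((c + 1) mod 4)"
  proof -
    have "c = 0 \<or> c = 1 \<or> c = 2 \<or> c = 3" using rc(2) by auto
    then show ?thesis by (elim disjE) simp_all
  qed
  then have "of_nat r = (of_nat c + 1 :: z4) \<longleftrightarrow> r = (c + 1) mod 4"
    using rc by (simp only: of_nat_z4_eq_iff)
  then show "pauli1 (1, 0) $$ (r, c) = X_gate $$ (r, c)"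
    using rc by (simp add: pauli1_def X_gate_def)
qed (auto simp: X_gate_def pauli1_def)

lemma pauli1_Z: "pauli1 (0, 1) = Z_gate"
  by (rule eq_matI) (auto simp: pauli1_def Z_gate_def of_nat_z4_eq_iff ipow_of_nat)

text \<open>By \<open>Z X = \<i> X Z\<close>, moving \<open>Z^b\<close> to the right past
  \<open>X^a\<close> costs \<open>ipow (b * a)\<close>.\<close>

lemma pauli1_mult: "pauli1 p * pauli1 q = ipow (snd p * fst q) \<cdot>\<^sub>m pauli1 (p + q)"
proof (rule eq_matI)
  fix r c assume "r < dim_row (ipow (snd p * fst q) \<cdot>\<^sub>m pauli1 (p + q))"
    "c < dim_col (ipow (snd p * fst q) \<cdot>\<^sub>m pauli1 (p + q))"
  then have rc: "r < 4" "c < 4" by auto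
  have "(pauli1 p * pauli1 q) $$ (r, c) = (\<Sum>k<4. (\<lambda>x :: z4.
      (if of_nat r = x + fst p then ipow (snd p * x) else 0) *
      (if x = of_nat c + fst q then ipow (snd q * of_nat c) else 0)) (of_nat k))"
    using rc by (auto simp: pauli1_def scalar_prod_def atLeast0LessThan intro!: sum.cong)
  also have "\<dots> = (\<Sum>x :: z4\<in>UNIV. if x = of_nat c + fst q then
      (if of_nat r = x + fst p then ipow (snd p * x) * ipow (snd q * of_nat c) else 0) else 0)"
    by (subst sum_of_nat_z4) (intro sum.cong refl, auto)
  also have "\<dots> = (ipow (snd p * fst q) \<cdot>\<^sub>m pauli1 (p + q)) $$ (r, c)"
  proof -
    have "of_nat r = of_nat c + fst q + fst p \<longleftrightarrow> of_nat r = of_nat c + fst (p + q)"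
      by (simp add: ac_simps)
    moreover have "ipow (snd p * (of_nat c + fst q)) * ipow (snd q * of_nat c) =
        ipow (snd p * fst q) * ipow (snd (p + q) * of_nat c)"
      by (simp add: distrib_left distrib_right ipow_add)
    ultimately show ?thesis using rc by (simp add: pauli1_def)
  qed
  finally show "(pauli1 p * pauli1 q) $$ (r, c) = (ipow (snd p * fst q) \<cdot>\<^sub>m pauli1 (p + q)) $$ (r, c)" .
qed auto

lemma diag_mat_mult:
  assumes "A \<in> carrier_mat n n"
  shows "mat n n (\<lambda>(r, c). if r = c then f r else 0) * A = mat n n (\<lambda>(r, c). f r * A $$ (r, c))"
    and "A * mat n n (\<lambda>(r, c). if r = c then f r else 0) = mat n n (\<lambda>(r, c). A $$ (r, c) * f c)"
proof -
  show "mat n n (\<lambda>(r, c). if r = c then f r else 0) * A = mat n n (\<lambda>(r, c). f r * A $$ (r, c))"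
    using assms by (intro eq_matI) (auto simp: scalar_prod_def if_distrib[of "\<lambda>x. x * _"] cong: if_cong)
  show "A * mat n n (\<lambda>(r, c). if r = c then f r else 0) = mat n n (\<lambda>(r, c). A $$ (r, c) * f c)"
    using assms by (intro eq_matI) (auto simp: scalar_prod_def if_distrib[of "\<lambda>x. _ * x"] cong: if_cong)
qed

lemma S_gate_diag: "S_gate = mat 4 4 (\<lambda>(r, c). if r = c then s_phase (of_nat r) else 0)"
  by (rule eq_matI) (auto simp: S_gate_def s_phase_of_nat)

lemma CZ_gate_diag:
  "CZ_gate = mat 16 16 (\<lambda>(r, c). if r = c then ipow (of_nat (r div 4) * of_nat (r mod 4)) else 0)"
  by (rule eq_matI) (auto simp: CZ_gate_def simp flip: ipow_of_nat)

text \<open>\<open>X^a\<close> shifts \<open>x\<close> to \<open>x + a\<close>; there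
  \<open>s_phase_add\<close> splits the phase into a constant, the old phase and
  \<open>ipow (x * a)\<close>, which is an additional \<open>Z^a\<close>.\<close>

lemma S_gate_pauli1:
  "S_gate * pauli1 (a, b) = s_phase a \<cdot>\<^sub>m (pauli1 (a, b + a) * S_gate)"
  unfolding S_gate_diag diag_mat_mult[OF pauli1_carrier(1)]
  by (rule eq_matI) (auto simp: pauli1_def s_phase_add algebra_simps ipow_add)

section \<open>Circulant matrices and the gate \<open>T\<close>\<close>

definition circulant :: "(z4 \<Rightarrow> complex) \<Rightarrow> complex mat" where
  "circulant f = mat 4 4 (\<lambda>(r, c). f (of_nat r - of_nat c))"

text \<open>Circulant matrices are polynomials in \<open>X\<close>, so products are convolutions on
  Z/4. The four summands are written out in order to reduce identities between circulants to four
  scalar checks.\<close>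

lemma circulant_mult:
  "circulant f * circulant g = circulant (\<lambda>x. f x * g 0 + f (x - 1) * g 1 + f (x - 2) * g 2 + f (x - 3) * g 3)"
proof (rule eq_matI)
  fix r c assume "r < dim_row (circulant (\<lambda>x. f x * g 0 + f (x - 1) * g 1 + f (x - 2) * g 2 + f (x - 3) * g 3))"
    "c < dim_col (circulant (\<lambda>x. f x * g 0 + f (x - 1) * g 1 + f (x - 2) * g 2 + f (x - 3) * g 3))"
  then have rc: "r < 4" "c < 4" by (auto simp: circulant_def)
  then have "(circulant f * circulant g) $$ (r, c) =
      (\<Sum>k<4. (\<lambda>x. f (of_nat r - x) * g (x - of_nat c)) (of_nat k))"
    by (simp add: circulant_def scalar_prod_def atLeast0LessThan)
  also have "\<dots> = (\<Sum>x\<in>UNIV. f (of_nat r - x) * g (x - of_nat c))"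
    by (rule sum_of_nat_z4)
  also have "\<dots> = (\<Sum>x\<in>UNIV. f (of_nat r - of_nat c - x) * g x)"
    by (rule sum.reindex_bij_witness[of _ "\<lambda>x. x + of_nat c" "\<lambda>x. x - of_nat c"]) auto
  finally show "(circulant f * circulant g) $$ (r, c) =
      circulant (\<lambda>x. f x * g 0 + f (x - 1) * g 1 + f (x - 2) * g 2 + f (x - 3) * g 3) $$ (r, c)"
    using rc by (simp add: sum_z4 circulant_def)
qed (auto simp: circulant_def)

lemma mat_adjoint_circulant: "mat_adjoint (circulant f) = circulant (\<lambda>x. cnj (f (- x)))"
  by (rule eq_matI) (auto simp: circulant_def index_mat_adjoint)

lemma circulant_one: "1\<^sub>m 4 = circulant (\<lambda>x. if x = 0 then 1 else 0)"
  by (rule eq_matI) (auto simp: circulant_def of_nat_z4_eq_iff)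

lemma circulant_cong: "(\<And>x. f x = g x) \<Longrightarrow> circulant f = circulant g"
  by (simp add: circulant_def)

text \<open>The discrete Fourier transform of \<open>s_phase\<close>: a quarter of the sum of
  \<open>s_phase y * ipow (x * y)\<close> over all \<open>y\<close>.\<close>

definition t_coeff :: "z4 \<Rightarrow> complex" where
  "t_coeff x = (if x = 0 then sqrt_i / 2 else if x = 2 then - sqrt_i / 2 else 1 / 2)"

lemma t_coeff_simps [simp]:
  "t_coeff 0 = sqrt_i / 2" "t_coeff 1 = 1 / 2" "t_coeff 2 = - sqrt_i / 2" "t_coeff 3 = 1 / 2"
  by (simp_all add: t_coeff_def)

lemma T_gate_circulant: "T_gate = circulant t_coeff"
proof (rule eq_matI)
  fix r c assume "r < dim_row (circulant t_coeff)" "c < dim_col (circulant t_coeff)"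
  then have "r = 0 \<or> r = 1 \<or> r = 2 \<or> r = 3" "c = 0 \<or> c = 1 \<or> c = 2 \<or> c = 3"
    by (auto simp: circulant_def)
  then show "T_gate $$ (r, c) = circulant t_coeff $$ (r, c)"
    by (elim disjE) (simp_all add: T_gate_def circulant_def mat_of_rows_list_def)
qed (simp_all add: T_gate_def circulant_def mat_of_rows_list_def)

lemma T_gate_carrier [simp]: "T_gate \<in> carrier_mat 4 4" "dim_row T_gate = 4" "dim_col T_gate = 4"
  by (simp_all add: T_gate_circulant circulant_def)

lemma T_gate_square:
  "T_gate * T_gate = circulant (\<lambda>x. if x = 0 then (1 + \<i>) / 2 else if x = 2 then (1 - \<i>) / 2 else 0)"
  unfolding T_gate_circulant circulant_mult
proof (rule circulant_cong)
  fix x :: z4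
  show "t_coeff x * t_coeff 0 + t_coeff (x - 1) * t_coeff 1 + t_coeff (x - 2) * t_coeff 2
      + t_coeff (x - 3) * t_coeff 3
    = (if x = 0 then (1 + \<i>) / 2 else if x = 2 then (1 - \<i>) / 2 else 0)"
    by (cases x rule: z4_cases) (simp_all add: sqrt_i_square add_divide_distrib diff_divide_distrib)
qed

text \<open>The eigenvalues of \<open>T\<close> are the values of \<open>s_phase\<close>, all of
  them eighth roots of unity. Squaring three times passes through \<open>T^4 = X^2\<close>. The
  purpose is to have \<open>T^7\<close> as an inverse of \<open>T\<close> that is itself a product
  of gates.\<close>

lemma T_gate_power8:
  "((T_gate * T_gate) * (T_gate * T_gate)) * ((T_gate * T_gate) * (T_gate * T_gate)) = 1\<^sub>m 4"
proof -
  have 4: "(T_gate * T_gate) * (T_gate * T_gate) = circulant (\<lambda>x. if x = 2 then 1 else 0)"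
    unfolding T_gate_square circulant_mult
  proof (rule circulant_cong)
    fix x :: z4
    let ?f = "\<lambda>x :: z4. if x = 0 then (1 + \<i>) / 2 else if x = 2 then (1 - \<i>) / 2 else 0"
    show "?f x * ?f 0 + ?f (x - 1) * ?f 1 + ?f (x - 2) * ?f 2 + ?f (x - 3) * ?f 3
      = (if x = 2 then 1 else 0)"
      by (cases x rule: z4_cases) (simp_all add: complex_eq_iff)
  qed
  show ?thesis
    unfolding 4 circulant_mult circulant_one
  proof (rule circulant_cong)
    fix x :: z4
    let ?f = "\<lambda>x :: z4. if x = 2 then 1 else 0 :: complex"
    show "?f x * ?f 0 + ?f (x - 1) * ?f 1 + ?f (x - 2) * ?f 2 + ?f (x - 3) * ?f 3
      = (if x = 0 then 1 else 0)"
      by (cases x rule: z4_cases) simp_all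
  qed
qed

lemma T_gate_unitary: "T_gate * mat_adjoint T_gate = 1\<^sub>m 4" "mat_adjoint T_gate * T_gate = 1\<^sub>m 4"
proof -
  let ?f = t_coeff and ?g = "\<lambda>x. cnj (t_coeff (- x))"
  have "?f x * ?g 0 + ?f (x - 1) * ?g 1 + ?f (x - 2) * ?g 2 + ?f (x - 3) * ?g 3
      = (if x = 0 then 1 else 0)" for x
    by (cases x rule: z4_cases) (simp_all add: sqrt_i_cnj)
  then show "T_gate * mat_adjoint T_gate = 1\<^sub>m 4"
    unfolding T_gate_circulant mat_adjoint_circulant circulant_mult circulant_one
    by (rule circulant_cong)
  have "?g x * ?f 0 + ?g (x - 1) * ?f 1 + ?g (x - 2) * ?f 2 + ?g (x - 3) * ?f 3
      = (if x = 0 then 1 else 0)" for x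
    by (cases x rule: z4_cases) (simp_all add: sqrt_i_cnj mult.commute[of "cnj sqrt_i"])
  then show "mat_adjoint T_gate * T_gate = 1\<^sub>m 4"
    unfolding T_gate_circulant mat_adjoint_circulant circulant_mult circulant_one
    by (rule circulant_cong)
qed

text \<open>\<open>T\<close> is to \<open>X\<close> what \<open>S\<close> is to \<open>Z\<close>: it acts on the eigenvectors of \<open>X\<close> by the phases of \<open>S\<close>.\<close>

lemma T_gate_pauli1:
  "T_gate * pauli1 (a, b) = cnj (s_phase b) \<cdot>\<^sub>m (pauli1 (a - b, b) * T_gate)"
proof (rule eq_matI)
  fix r c assume "r < dim_row (cnj (s_phase b) \<cdot>\<^sub>m (pauli1 (a - b, b) * T_gate))"
    "c < dim_col (cnj (s_phase b) \<cdot>\<^sub>m (pauli1 (a - b, b) * T_gate))"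
  then have rc: "r < 4" "c < 4" by (auto simp: T_gate_circulant circulant_def)
  have "(T_gate * pauli1 (a, b)) $$ (r, c) =
     (\<Sum>k<4. (\<lambda>x. t_coeff (of_nat r - x) * (if x = of_nat c + a then ipow (b * of_nat c) else 0)) (of_nat k))"
    using rc unfolding T_gate_circulant
    by (simp add: circulant_def scalar_prod_def atLeast0LessThan pauli1_def cong: if_cong)
  also have "\<dots> = t_coeff (of_nat r - of_nat c - a) * ipow (b * of_nat c)"
    by (subst sum_of_nat_z4) (simp add: if_distrib[of "\<lambda>x. _ * x"] diff_diff_eq cong: if_cong)
  finally have L: "(T_gate * pauli1 (a, b)) $$ (r, c) = t_coeff (of_nat r - of_nat c - a) * ipow (b * of_nat c)" .
  have "(pauli1 (a - b, b) * T_gate) $$ (r, c) =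
     (\<Sum>k<4. (\<lambda>x. (if x = of_nat r - a + b then ipow (b * x) else 0) * t_coeff (x - of_nat c)) (of_nat k))"
    using rc unfolding T_gate_circulant
    by (auto simp: circulant_def scalar_prod_def atLeast0LessThan pauli1_def algebra_simps intro!: sum.cong)
  also have "\<dots> = ipow (b * (of_nat r - a + b)) * t_coeff (of_nat r - a + b - of_nat c)"
    by (subst sum_of_nat_z4) (simp add: if_distrib[of "\<lambda>x. x * _"] cong: if_cong)
  finally have R: "(pauli1 (a - b, b) * T_gate) $$ (r, c) =
    ipow (b * (of_nat r - a + b)) * t_coeff (of_nat r - a + b - of_nat c)" .
  \<comment> \<open>Apart from the common factor \<open>ipow (b * of_nat c)\<close>, both entries
    depend on \<open>r\<close>, \<open>c\<close> and \<open>a\<close> only through \<open>m\<close>.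
    What remains is the Fourier counterpart of \<open>s_phase_add\<close>.\<close>
  define m :: z4 where "m = of_nat r - of_nat c - a"
  have "ipow (b * (m + b)) * t_coeff (m + b) = s_phase b * t_coeff m"
    by (cases m rule: z4_cases; cases b rule: z4_cases) (simp_all add: sqrt_i_square)
  moreover have "of_nat r - a + b = m + b + of_nat c" "of_nat r - a + b - of_nat c = m + b"
    by (simp_all add: m_def)
  ultimately have "cnj (s_phase b) * ((pauli1 (a - b, b) * T_gate) $$ (r, c)) =
      cnj (s_phase b) * s_phase b * t_coeff m * ipow (b * of_nat c)"
    unfolding R by (simp add: distrib_left ipow_add mult_ac)
  also have "cnj (s_phase b) * s_phase b = 1"
    by (cases b rule: z4_cases) (simp_all add: mult.commute[of "cnj sqrt_i"] sqrt_i_cnj)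
  finally show "(T_gate * pauli1 (a, b)) $$ (r, c) =
      (cnj (s_phase b) \<cdot>\<^sub>m (pauli1 (a - b, b) * T_gate)) $$ (r, c)"
    using rc by (simp add: L m_def)
qed (auto simp: T_gate_circulant circulant_def)

text \<open>Expanding \<open>(j + a) * (k + a') = j * k + a' * j + a * k + a * a'\<close> shows that
  each factor receives the \<open>X\<close> exponent of the other as an additional \<open>Z\<close>
  exponent.\<close>

lemma CZ_gate_pauli1:
  "CZ_gate * (pauli1 (a, b) \<otimes>\<^sub>K pauli1 (a', b')) =
     ipow (a * a') \<cdot>\<^sub>m ((pauli1 (a, b + a') \<otimes>\<^sub>K pauli1 (a', b' + a)) * CZ_gate)"
proof -
  have c: "pauli1 p \<otimes>\<^sub>K pauli1 q \<in> carrier_mat 16 16" for p q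
    using kron_carrier[OF pauli1_carrier(1) pauli1_carrier(1)] by simp
  show ?thesis
    unfolding CZ_gate_diag diag_mat_mult[OF c]
    by (rule eq_matI) (auto simp: index_kron pauli1_def algebra_simps ipow_add)
qed

section \<open>Pauli operators on several qudits\<close>

text \<open>Vectors are total functions, seen by the operator only on \<open>1..n\<close>; hence
  \<open>pauli_cong\<close>. Splitting off the last factor fits the way \<open>on_factor\<close>
  changes when \<open>n\<close> grows.\<close>

primrec pauli :: "nat \<Rightarrow> (nat \<Rightarrow> z4 \<times> z4) \<Rightarrow> complex mat" where
  "pauli 0 v = 1\<^sub>m 1"
| "pauli (Suc n) v = pauli n v \<otimes>\<^sub>K pauli1 (v (Suc n))"

definition single :: "nat \<Rightarrow> z4 \<times> z4 \<Rightarrow> nat \<Rightarrow> z4 \<times> z4" where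
  "single i p = (\<lambda>_. 0)(i := p)"

lemma single_same [simp]: "single i p i = p"
  and single_other [simp]: "j \<noteq> i \<Longrightarrow> single i p j = 0"
  by (simp_all add: single_def)

lemma pauli_carrier [simp]: "pauli n v \<in> carrier_mat (4 ^ n) (4 ^ n)"
proof (induction n)
  case (Suc n)
  then show ?case using kron_carrier[OF Suc pauli1_carrier(1)] by (simp add: mult.commute)
qed simp

lemma dim_pauli [simp]: "dim_row (pauli n v) = 4 ^ n" "dim_col (pauli n v) = 4 ^ n"
  using pauli_carrier[of n v] unfolding carrier_mat_def by auto

lemma pauli_cong: "pauli n v = pauli n w" if "\<And>i. 1 \<le> i \<Longrightarrow> i \<le> n \<Longrightarrow> v i = w i"
  using that by (induction n) simp_all

lemma pauli_zero: "pauli n (\<lambda>_. 0) = 1\<^sub>m (4 ^ n)"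
  by (induction n) (simp_all add: pauli1_0 mult.commute)

lemma pauli_single_outside [simp]: "n < i \<Longrightarrow> pauli n (single i p) = 1\<^sub>m (4 ^ n)"
  unfolding pauli_zero[symmetric] by (rule pauli_cong) simp

lemma smult_smult_mat: "a \<cdot>\<^sub>m (b \<cdot>\<^sub>m A) = (a * b) \<cdot>\<^sub>m A" for A :: "complex mat"
  by (rule eq_matI) auto

lemma pauli_mult:
  "pauli n v * pauli n w = ipow (\<Sum>i=1..n. snd (v i) * fst (w i)) \<cdot>\<^sub>m pauli n (\<lambda>i. v i + w i)"
proof (induction n)
  case (Suc n)
  have "pauli (Suc n) v * pauli (Suc n) w =
      (pauli n v * pauli n w) \<otimes>\<^sub>K (pauli1 (v (Suc n)) * pauli1 (w (Suc n)))"
    by (simp add: kron_mult[OF pauli_carrier pauli_carrier pauli1_carrier(1) pauli1_carrier(1)])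
  also have "\<dots> = ipow (\<Sum>i=1..Suc n. snd (v i) * fst (w i)) \<cdot>\<^sub>m pauli (Suc n) (\<lambda>i. v i + w i)"
    unfolding Suc pauli1_mult
    by (simp add: kron_smult ipow_add smult_smult_mat mult.commute)
  finally show ?case .
qed auto

text \<open>The sign makes \<open>ipow (symp n v w)\<close> the factor gained when
  \<open>pauli n v\<close> moves to the right past \<open>pauli n w\<close>.\<close>

definition symp :: "nat \<Rightarrow> (nat \<Rightarrow> z4 \<times> z4) \<Rightarrow> (nat \<Rightarrow> z4 \<times> z4) \<Rightarrow> z4" where
  "symp n v w = (\<Sum>i=1..n. snd (v i) * fst (w i) - fst (v i) * snd (w i))"

lemma pauli_commute: "pauli n v * pauli n w = ipow (symp n v w) \<cdot>\<^sub>m (pauli n w * pauli n v)"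
proof -
  let ?A = "\<Sum>i=1..n. snd (v i) * fst (w i)" and ?B = "\<Sum>i=1..n. snd (w i) * fst (v i)"
  have "?A = symp n v w + ?B"
    unfolding symp_def by (simp add: sum_subtractf mult.commute)
  then show ?thesis
    unfolding pauli_mult by (simp add: ipow_add smult_smult_mat add.commute)
qed

lemma symp_single_right: "symp n v (single j p) = snd (v j) * fst p - fst (v j) * snd p"
  if "1 \<le> j" "j \<le> n"
proof -
  have "symp n v (single j p) =
      (\<Sum>i=1..n. if i = j then snd (v j) * fst p - fst (v j) * snd p else 0)"
    unfolding symp_def by (intro sum.cong) auto
  with that show ?thesis by simp
qed

lemma symp_single_left: "symp n (single j p) v = snd p * fst (v j) - fst p * snd (v j)"
  if "1 \<le> j" "j \<le> n"
proof -
  have "symp n (single j p) v =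
      (\<Sum>i=1..n. if i = j then snd p * fst (v j) - fst p * snd (v j) else 0)"
    unfolding symp_def by (intro sum.cong) auto
  with that show ?thesis by simp
qed

section \<open>Operators placed on one factor or on two neighbouring factors\<close>

lemma on_factor_carrier [simp]:
  assumes "A \<in> carrier_mat 4 4" "1 \<le> i" "i \<le> n"
  shows "on_factor n i A \<in> carrier_mat (4 ^ n) (4 ^ n)"
proof -
  have "n = (i - 1) + 1 + (n - i)" using assms by simp
  then have "(4::nat) ^ n = 4 ^ (i - 1) * 4 * 4 ^ (n - i)"
    by (metis power_add power_one_right)
  then show ?thesis
    using assms(1) unfolding on_factor_def carrier_mat_def by simp
qed

lemma on_factor_Suc: "i \<le> n \<Longrightarrow> on_factor (Suc n) i A = on_factor n i A \<otimes>\<^sub>K 1\<^sub>m 4"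
  by (simp add: on_factor_def Suc_diff_le kron_assoc mult.commute)

lemma on_factor_last: "on_factor (Suc n) (Suc n) A = 1\<^sub>m (4 ^ n) \<otimes>\<^sub>K A"
  using kron_one_right[of "1\<^sub>m (4 ^ n) \<otimes>\<^sub>K A"] by (simp add: on_factor_def)

lemma on_factor_mult:
  assumes "A \<in> carrier_mat 4 4" "B \<in> carrier_mat 4 4"
  shows "on_factor n i (A * B) = on_factor n i A * on_factor n i B"
  unfolding on_factor_def
  by (simp add: kron_mult[OF kron_carrier[OF one_carrier_mat assms(1)] kron_carrier[OF one_carrier_mat assms(2)]
        one_carrier_mat one_carrier_mat] kron_mult[OF one_carrier_mat one_carrier_mat assms])

lemma on_factor_smult: "on_factor n i (c \<cdot>\<^sub>m A) = c \<cdot>\<^sub>m on_factor n i A"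
  by (simp add: on_factor_def kron_smult)

text \<open>Induction upward from \<open>n = i\<close>: at the base \<open>A\<close> sits on the
  last factor, and each further factor only tensors it with an identity.\<close>

lemma on_factor_pauli:
  assumes A: "A \<in> carrier_mat 4 4" and "1 \<le> i" "i \<le> n"
    and comm: "A * pauli1 (v i) = c \<cdot>\<^sub>m (pauli1 p * A)"
  shows "on_factor n i A * pauli n v = c \<cdot>\<^sub>m (pauli n (v(i := p)) * on_factor n i A)"
  using \<open>i \<le> n\<close>
proof (induction n rule: dec_induct)
  case base
  obtain m where i: "i = Suc m" using \<open>1 \<le> i\<close> by (cases i) auto
  have "pauli m (v(i := p)) = pauli m v" by (rule pauli_cong) (simp add: i)
  then show ?case
    unfolding i on_factor_last pauli.simps
    using comm i
    by (simp add: kron_mult[OF one_carrier_mat pauli_carrier A pauli1_carrier(1)]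
      kron_mult[OF pauli_carrier one_carrier_mat pauli1_carrier(1) A] kron_smult
      left_mult_one_mat[OF pauli_carrier] right_mult_one_mat[OF pauli_carrier])
next
  case (step n)
  have F: "on_factor n i A \<in> carrier_mat (4 ^ n) (4 ^ n)" using A \<open>1 \<le> i\<close> step by simp
  show ?case
    unfolding on_factor_Suc[OF step(1)] pauli.simps
    using step
    by (simp add: kron_mult[OF F pauli_carrier one_carrier_mat pauli1_carrier(1)]
      kron_mult[OF pauli_carrier F pauli1_carrier(1) one_carrier_mat] kron_smult
      left_mult_one_mat[OF pauli1_carrier(1)] right_mult_one_mat[OF pauli1_carrier(1)]
      del: fun_upd_apply add: fun_upd_other)
qed

lemma pauli_single: "pauli n (single i p) = on_factor n i (pauli1 p)" if "1 \<le> i" "i \<le> n"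
  using \<open>i \<le> n\<close>
proof (induction n rule: dec_induct)
  case base
  obtain m where "i = Suc m" using \<open>1 \<le> i\<close> by (cases i) auto
  then show ?case by (simp add: on_factor_last)
next
  case (step n)
  then show ?case by (simp add: on_factor_Suc pauli1_0)
qed

lemma on_factors_from_Suc:
  "Suc i \<le> n \<Longrightarrow> on_factors_from (Suc n) i B = on_factors_from n i B \<otimes>\<^sub>K 1\<^sub>m 4"
  using Suc_diff_le[of "Suc i" n] by (simp add: on_factors_from_def kron_assoc mult.commute)

lemma on_factors_from_last:
  "on_factors_from (Suc (Suc n)) (Suc n) B = 1\<^sub>m (4 ^ n) \<otimes>\<^sub>K B"
  using kron_one_right[of "1\<^sub>m (4 ^ n) \<otimes>\<^sub>K B"] by (simp add: on_factors_from_def)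

lemma on_factors_from_carrier [simp]:
  assumes "B \<in> carrier_mat 16 16" "1 \<le> i" "Suc i \<le> n"
  shows "on_factors_from n i B \<in> carrier_mat (4 ^ n) (4 ^ n)"
proof -
  have "n = (i - 1) + 2 + (n - (i + 1))" using assms by simp
  then have "(4::nat) ^ n = 4 ^ (i - 1) * 4 ^ 2 * 4 ^ (n - (i + 1))"
    by (metis power_add)
  then show ?thesis
    using assms(1) unfolding on_factors_from_def carrier_mat_def by simp
qed

lemma on_factors_from_pauli:
  assumes A: "A \<in> carrier_mat 16 16" and "1 \<le> i" "Suc i \<le> n"
    and comm: "A * (pauli1 (v i) \<otimes>\<^sub>K pauli1 (v (Suc i))) = c \<cdot>\<^sub>m ((pauli1 p \<otimes>\<^sub>K pauli1 q) * A)"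
  shows "on_factors_from n i A * pauli n v =
    c \<cdot>\<^sub>m (pauli n (v(i := p, Suc i := q)) * on_factors_from n i A)"
  using \<open>Suc i \<le> n\<close>
proof (induction n rule: dec_induct)
  case base
  obtain m where i: "i = Suc m" using \<open>1 \<le> i\<close> by (cases i) auto
  have P: "pauli1 a \<otimes>\<^sub>K pauli1 b \<in> carrier_mat 16 16" for a b
    using kron_carrier[OF pauli1_carrier(1) pauli1_carrier(1)] by simp
  have "pauli m (v(i := p, Suc i := q)) = pauli m v" by (rule pauli_cong) (simp add: i)
  then show ?case
    unfolding i on_factors_from_last pauli.simps kron_assoc
    using comm i
    by (simp add: kron_mult[OF one_carrier_mat pauli_carrier A P]
      kron_mult[OF pauli_carrier one_carrier_mat P A] kron_smult
      left_mult_one_mat[OF pauli_carrier] right_mult_one_mat[OF pauli_carrier])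
next
  case (step n)
  have F: "on_factors_from n i A \<in> carrier_mat (4 ^ n) (4 ^ n)" using A \<open>1 \<le> i\<close> step by simp
  show ?case
    unfolding on_factors_from_Suc[OF step(1)] pauli.simps
    using step
    by (simp add: kron_mult[OF F pauli_carrier one_carrier_mat pauli1_carrier(1)]
      kron_mult[OF pauli_carrier F pauli1_carrier(1) one_carrier_mat] kron_smult
      left_mult_one_mat[OF pauli1_carrier(1)] right_mult_one_mat[OF pauli1_carrier(1)]
      del: fun_upd_apply add: fun_upd_other)
qed

section \<open>The commutant of the Pauli operators\<close>

lemma commutes_last_factor:
  assumes M: "M \<in> carrier_mat (N * 4) (N * 4)"
    and X: "M * (1\<^sub>m N \<otimes>\<^sub>K pauli1 (1, 0)) = (1\<^sub>m N \<otimes>\<^sub>K pauli1 (1, 0)) * M"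
    and Z: "M * (1\<^sub>m N \<otimes>\<^sub>K pauli1 (0, 1)) = (1\<^sub>m N \<otimes>\<^sub>K pauli1 (0, 1)) * M"
  shows "\<exists>M' \<in> carrier_mat N N. M = M' \<otimes>\<^sub>K 1\<^sub>m 4"
proof -
  have z: "pauli1 (0, 1) = mat 4 4 (\<lambda>(r, c). if r = c then ipow (of_nat r) else 0)"
    by (rule eq_matI) (auto simp: pauli1_def of_nat_z4_eq_iff)
  have Z1: "1\<^sub>m N \<otimes>\<^sub>K pauli1 (0, 1) =
      mat (N * 4) (N * 4) (\<lambda>(r, c). if r = c then ipow (of_nat (r mod 4)) else 0)"
  proof (rule eq_matI)
    fix r c assume "r < dim_row (mat (N * 4) (N * 4) (\<lambda>(r, c). if r = c then ipow (of_nat (r mod 4)) else 0))"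
      "c < dim_col (mat (N * 4) (N * 4) (\<lambda>(r, c). if r = c then ipow (of_nat (r mod 4)) else 0))"
    then have rc: "r < N * 4" "c < N * 4" by auto
    moreover have "r = c" if "r div 4 = c div 4" "r mod 4 = c mod 4" using that by (metis div_mult_mod_eq)
    ultimately show "(1\<^sub>m N \<otimes>\<^sub>K pauli1 (0, 1)) $$ (r, c) =
      mat (N * 4) (N * 4) (\<lambda>(r, c). if r = c then ipow (of_nat (r mod 4)) else 0) $$ (r, c)"
      by (auto simp: index_kron z)
  qed auto
  \<comment> \<open>\<open>Z\<close> on the last factor has different eigenvalues for different
    residues modulo 4, so \<open>M\<close> cannot mix them.\<close>
  have diag: "M $$ (r, c) = 0" if rc: "r < N * 4" "c < N * 4" and ne: "r mod 4 \<noteq> c mod 4" for r c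
  proof -
    have "M $$ (r, c) * ipow (of_nat (c mod 4)) = ipow (of_nat (r mod 4)) * M $$ (r, c)"
      using arg_cong[OF Z[unfolded Z1 diag_mat_mult[OF M]], of "\<lambda>A. A $$ (r, c)"] rc by simp
    moreover have "ipow (of_nat (c mod 4)) \<noteq> ipow (of_nat (r mod 4))"
      using ne by (simp add: ipow_inj of_nat_z4_eq_iff)
    ultimately show ?thesis by (auto simp: mult.commute)
  qed
  \<comment> \<open>The permutation of the basis by \<open>X\<close> on the last factor: the last
    base-4 digit increases cyclically and the others stay.\<close>
  define \<sigma> where "\<sigma> c = 4 * (c div 4) + Suc (c mod 4) mod 4" for c
  have \<sigma>_div: "\<sigma> c div 4 = c div 4" and \<sigma>_mod: "\<sigma> c mod 4 = Suc c mod 4" for c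
    by (simp_all add: \<sigma>_def mod_Suc_eq)
  have \<sigma>_less: "\<sigma> c < N * 4" if "c < N * 4" for c
    using that \<sigma>_div[of c] by (metis div_less_iff_less_mult zero_less_numeral)
  have \<sigma>_inj: "\<sigma> k = \<sigma> r \<longleftrightarrow> k = r" for k r
  proof
    assume "\<sigma> k = \<sigma> r"
    then have d: "k div 4 = r div 4" and "Suc k mod 4 = Suc r mod 4"
      using \<sigma>_div[of k] \<sigma>_div[of r] \<sigma>_mod[of k] \<sigma>_mod[of r] by simp_all
    then have m: "k mod 4 = r mod 4" by (simp add: mod_Suc split: if_splits)
    have "k = k div 4 * 4 + k mod 4" by simp
    also have "\<dots> = r" unfolding d m by simp
    finally show "k = r" .
  qed simp
  have X1: "1\<^sub>m N \<otimes>\<^sub>K pauli1 (1, 0) = mat (N * 4) (N * 4) (\<lambda>(r, c). if r = \<sigma> c then 1 else 0)"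
  proof (rule eq_matI)
    fix r c assume "r < dim_row (mat (N * 4) (N * 4) (\<lambda>(r, c). if r = \<sigma> c then 1 else 0 :: complex))"
      "c < dim_col (mat (N * 4) (N * 4) (\<lambda>(r, c). if r = \<sigma> c then 1 else 0 :: complex))"
    then have rc: "r < N * 4" "c < N * 4" by auto
    have "r = \<sigma> c \<longleftrightarrow> r div 4 = c div 4 \<and> r mod 4 = (c mod 4 + 1) mod 4"
      by (metis \<sigma>_div \<sigma>_mod div_mult_mod_eq mod_Suc_eq Suc_eq_plus1)
    with rc show "(1\<^sub>m N \<otimes>\<^sub>K pauli1 (1, 0)) $$ (r, c) =
        mat (N * 4) (N * 4) (\<lambda>(r, c). if r = \<sigma> c then 1 else 0) $$ (r, c)"
      by (auto simp: index_kron pauli1_X X_gate_def)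
  qed auto
  have \<sigma>_shift: "M $$ (\<sigma> r, \<sigma> c) = M $$ (r, c)" if rc: "r < N * 4" "c < N * 4" for r c
  proof -
    have "(M * (1\<^sub>m N \<otimes>\<^sub>K pauli1 (1, 0))) $$ (\<sigma> r, c) = M $$ (\<sigma> r, \<sigma> c)"
      using M rc \<sigma>_less by (auto simp: X1 scalar_prod_def if_distrib[of "\<lambda>x. _ * x"] cong: if_cong)
    moreover have "((1\<^sub>m N \<otimes>\<^sub>K pauli1 (1, 0)) * M) $$ (\<sigma> r, c) = M $$ (r, c)"
      using M rc \<sigma>_less
      by (auto simp: X1 scalar_prod_def \<sigma>_inj if_distrib[of "\<lambda>x. x * _"] cong: if_cong)
    ultimately show ?thesis by (simp add: X)
  qed
  \<comment> \<open>The three shifts without wrap-around already link all four positions in a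
    block.\<close>
  have shift: "M $$ (4 * a + Suc j, 4 * b + Suc j) = M $$ (4 * a + j, 4 * b + j)"
    if "a < N" "b < N" "Suc j < 4" for a b j
    using \<sigma>_shift[of "4 * a + j" "4 * b + j"] that by (simp add: \<sigma>_def)
  have const: "M $$ (4 * a + j, 4 * b + j) = M $$ (4 * a, 4 * b)" if ab: "a < N" "b < N" and "j < 4" for a b j
    using \<open>j < 4\<close>
  proof (induction j)
    case (Suc j)
    then show ?case using shift[OF ab, of j] by simp
  qed simp
  have "M = mat N N (\<lambda>(a, b). M $$ (4 * a, 4 * b)) \<otimes>\<^sub>K 1\<^sub>m 4"
  proof (rule eq_matI)
    fix r c assume "r < dim_row (mat N N (\<lambda>(a, b). M $$ (4 * a, 4 * b)) \<otimes>\<^sub>K 1\<^sub>m 4)"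
      "c < dim_col (mat N N (\<lambda>(a, b). M $$ (4 * a, 4 * b)) \<otimes>\<^sub>K 1\<^sub>m 4)"
    then have rc: "r < N * 4" "c < N * 4" by auto
    then have "r div 4 < N" "c div 4 < N" by auto
    with const[OF this, of "r mod 4"] diag[OF rc] rc
    show "M $$ (r, c) = (mat N N (\<lambda>(a, b). M $$ (4 * a, 4 * b)) \<otimes>\<^sub>K 1\<^sub>m 4) $$ (r, c)"
      by (cases "r mod 4 = c mod 4") (auto simp: index_kron mult.commute[of 4] simp flip: minus_mod_eq_div_mult)
  qed (use M in auto)
  then show ?thesis by (metis mat_carrier)
qed

text \<open>Commuting with \<open>X\<close> and \<open>Z\<close> on the last factor makes
  \<open>M\<close> act there as the identity, and what is left on the other factors inherits the
  hypothesis.\<close>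

lemma pauli_commutant:
  assumes "M \<in> carrier_mat (4 ^ n) (4 ^ n)"
    and "\<And>i p. 1 \<le> i \<Longrightarrow> i \<le> n \<Longrightarrow> p \<in> {(1, 0), (0, 1)} \<Longrightarrow>
      M * pauli n (single i p) = pauli n (single i p) * M"
  shows "\<exists>c. M = c \<cdot>\<^sub>m 1\<^sub>m (4 ^ n)"
  using assms
proof (induction n arbitrary: M)
  case 0
  then have "M = (M $$ (0, 0)) \<cdot>\<^sub>m 1\<^sub>m (4 ^ 0)" by (intro eq_matI) auto
  then show ?case by blast
next
  case (Suc n)
  have last: "pauli (Suc n) (single (Suc n) p) = 1\<^sub>m (4 ^ n) \<otimes>\<^sub>K pauli1 p" for p
    by (simp add: pauli_zero)
  obtain M' where M': "M' \<in> carrier_mat (4 ^ n) (4 ^ n)" "M = M' \<otimes>\<^sub>K 1\<^sub>m 4"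
    using commutes_last_factor[of M "4 ^ n"] Suc.prems(1) Suc.prems(2)[of "Suc n", unfolded last]
    by (auto simp: mult.commute)
  have "M' * pauli n (single i p) = pauli n (single i p) * M'"
    if ip: "1 \<le> i" "i \<le> n" "p \<in> {(1, 0), (0, 1)}" for i p
  proof (rule kron_one_cancel)
    have "pauli (Suc n) (single i p) = pauli n (single i p) \<otimes>\<^sub>K 1\<^sub>m 4"
      using ip by (simp add: pauli1_0)
    with Suc.prems(2)[of i p] ip M'
    show "(M' * pauli n (single i p)) \<otimes>\<^sub>K 1\<^sub>m 4 = (pauli n (single i p) * M') \<otimes>\<^sub>K 1\<^sub>m 4"
      by (simp add: kron_mult[OF M'(1) pauli_carrier one_carrier_mat one_carrier_mat]
        kron_mult[OF pauli_carrier M'(1) one_carrier_mat one_carrier_mat] del: pauli.simps)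
  qed (use M'(1) in auto)
  from Suc.IH[OF M'(1) this] obtain c where "M' = c \<cdot>\<^sub>m 1\<^sub>m (4 ^ n)" by blast
  then show ?case using M' by (auto simp: kron_smult mult.commute)
qed

section \<open>Unitary matrices and products of gates\<close>

abbreviation unitaries :: "nat \<Rightarrow> complex mat set" where
  "unitaries N \<equiv> carrier (unitary_group N)"

lemma unitaries_iff:
  "U \<in> unitaries N \<longleftrightarrow> U \<in> carrier_mat N N \<and> U * mat_adjoint U = 1\<^sub>m N \<and> mat_adjoint U * U = 1\<^sub>m N"
  by (simp add: unitary_group_def)

lemma unitaries_carrier [dest]: "U \<in> unitaries N \<Longrightarrow> U \<in> carrier_mat N N"
  by (simp add: unitaries_iff)

lemma mult_unitary_group [simp]: "U \<otimes>\<^bsub>unitary_group N\<^esub> V = U * V" "\<one>\<^bsub>unitary_group N\<^esub> = 1\<^sub>m N"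
  by (simp_all add: unitary_group_def)

lemma unitaries_mult: "U \<in> unitaries N \<Longrightarrow> V \<in> unitaries N \<Longrightarrow> U * V \<in> unitaries N"
  using monoid.m_closed[OF group.is_monoid[OF group_unitary_group]] by simp

lemma unitaries_one: "1\<^sub>m N \<in> unitaries N"
  by (simp add: unitaries_iff mat_adjoint_one)

lemma mat_adjoint_smult: "mat_adjoint (c \<cdot>\<^sub>m A) = cnj c \<cdot>\<^sub>m mat_adjoint A" for A :: "complex mat"
  by (rule eq_matI) (auto simp: index_mat_adjoint)

lemma smult_mult_smult:
  fixes A B :: "complex mat"
  assumes "A \<in> carrier_mat n m" "B \<in> carrier_mat m l"
  shows "(c \<cdot>\<^sub>m A) * (d \<cdot>\<^sub>m B) = (c * d) \<cdot>\<^sub>m (A * B)"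
  using assms
  by (simp add: mult_smult_assoc_mat[of A n m _ l] mult_smult_distrib[of A n m _ l] smult_smult_mat)

lemma one_smult_mat [simp]: "1 \<cdot>\<^sub>m A = A" for A :: "complex mat"
  by (rule eq_matI) auto

lemma unitaries_smult: "U \<in> unitaries N \<Longrightarrow> cmod c = 1 \<Longrightarrow> c \<cdot>\<^sub>m U \<in> unitaries N"
proof -
  assume U: "U \<in> unitaries N" and c: "cmod c = 1"
  have "c * cnj c = 1" using c by (simp add: complex_norm_square[symmetric])
  then show ?thesis
    using U by (auto simp: unitaries_iff mat_adjoint_smult smult_mult_smult[of _ N N _ N] mat_adjoint_carrier mult.commute)
qed

text \<open>The device for comparing phases: \<open>U\<close> cancels because it is invertible, and
  positive dimension provides an entry to compare.\<close>

lemma unitaries_scalar_eq: "c = d" if "c \<cdot>\<^sub>m U = d \<cdot>\<^sub>m U" "U \<in> unitaries N" "N > 0"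
proof -
  have U: "U \<in> carrier_mat N N" "mat_adjoint U \<in> carrier_mat N N" "U * mat_adjoint U = 1\<^sub>m N"
    using that(2) by (auto simp: unitaries_iff)
  have "(c \<cdot>\<^sub>m U) * mat_adjoint U = (d \<cdot>\<^sub>m U) * mat_adjoint U" by (simp add: that(1))
  then have "c \<cdot>\<^sub>m 1\<^sub>m N = d \<cdot>\<^sub>m (1\<^sub>m N :: complex mat)"
    using U by (simp add: mult_smult_assoc_mat[of U N N])
  from arg_cong[OF this, of "\<lambda>A. A $$ (0, 0)"] show ?thesis using \<open>N > 0\<close> by simp
qed

lemma unitaries_diag:
  assumes "\<And>i. i < N \<Longrightarrow> cmod (f i) = 1"
  shows "mat N N (\<lambda>(r, c). if r = c then f r else 0) \<in> unitaries N"
proof -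
  have [simp]: "f i * cnj (f i) = 1" if "i < N" for i
    using assms[OF that] by (simp add: complex_norm_square[symmetric])
  have "mat_adjoint (mat N N (\<lambda>(r, c). if r = c then f r else 0)) =
      mat N N (\<lambda>(r, c). if r = c then cnj (f r) else 0)"
    by (rule eq_matI) (auto simp: index_mat_adjoint)
  then show ?thesis
    by (auto simp: unitaries_iff diag_mat_mult[OF mat_carrier] mult.commute intro!: eq_matI)
qed

lemma unitaries_kron:
  assumes "U \<in> unitaries N" "V \<in> unitaries M"
  shows "U \<otimes>\<^sub>K V \<in> unitaries (N * M)"
proof -
  have c: "U \<in> carrier_mat N N" "V \<in> carrier_mat M M"
    "mat_adjoint U \<in> carrier_mat N N" "mat_adjoint V \<in> carrier_mat M M"
    using assms by (auto simp: unitaries_iff)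
  show ?thesis
    using assms kron_carrier[OF c(1,2)]
    by (simp add: unitaries_iff mat_adjoint_kron kron_mult[OF c(1,3,2,4)] kron_mult[OF c(3,1,4,2)])
qed

lemma unitaries_on_factor:
  assumes "A \<in> unitaries 4" "1 \<le> i" "i \<le> n"
  shows "on_factor n i A \<in> unitaries (4 ^ n)"
proof -
  have "n = (i - 1) + 1 + (n - i)" using assms by simp
  then have "(4::nat) ^ n = 4 ^ (i - 1) * 4 * 4 ^ (n - i)"
    by (metis power_add power_one_right)
  then show ?thesis
    unfolding on_factor_def using assms(1) by (simp add: unitaries_kron unitaries_one del: One_nat_def)
qed

lemma unitaries_on_factors_from:
  assumes "A \<in> unitaries 16" "1 \<le> i" "Suc i \<le> n"
  shows "on_factors_from n i A \<in> unitaries (4 ^ n)"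
proof -
  have "n = (i - 1) + 2 + (n - (i + 1))" using assms by simp
  then have "(4::nat) ^ n = 4 ^ (i - 1) * 4 ^ 2 * 4 ^ (n - (i + 1))"
    by (metis power_add)
  then have "(4::nat) ^ n = 4 ^ (i - 1) * 16 * 4 ^ (n - (i + 1))" by simp
  then show ?thesis
    unfolding on_factors_from_def using assms(1) by (simp add: unitaries_kron unitaries_one del: One_nat_def)
qed

lemma mat_adjoint_pauli1: "mat_adjoint (pauli1 p) = ipow (snd p * fst p) \<cdot>\<^sub>m pauli1 (- p)"
proof -
  have cnj: "cnj (ipow x) = ipow (- x)" for x
    by (cases x rule: z4_cases) simp_all
  show ?thesis
  proof (rule eq_matI)
    fix r c assume "r < dim_row (ipow (snd p * fst p) \<cdot>\<^sub>m pauli1 (- p))"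
      "c < dim_col (ipow (snd p * fst p) \<cdot>\<^sub>m pauli1 (- p))"
    then have rc: "r < 4" "c < 4" by auto
    have "of_nat r = of_nat c + fst (- p) \<longleftrightarrow> of_nat c = of_nat r + fst p"
      by (auto simp: algebra_simps)
    with rc show "mat_adjoint (pauli1 p) $$ (r, c) = (ipow (snd p * fst p) \<cdot>\<^sub>m pauli1 (- p)) $$ (r, c)"
      by (simp add: index_mat_adjoint pauli1_def cnj distrib_left flip: ipow_add)
  qed auto
qed

lemma unitaries_pauli1: "pauli1 p \<in> unitaries 4"
  by (simp add: unitaries_iff mat_adjoint_pauli1 mult_smult_distrib[of _ 4 4 _ 4]
    mult_smult_assoc_mat[of _ 4 4 _ 4] pauli1_mult smult_smult_mat pauli1_0 flip: ipow_add)

lemma unitaries_pauli: "pauli n v \<in> unitaries (4 ^ n)"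
proof (induction n)
  case (Suc n)
  from unitaries_kron[OF this unitaries_pauli1] show ?case by (simp add: mult.commute)
qed (simp add: unitaries_one)

section \<open>Equality up to phase and products of gates\<close>

definition phase_eq :: "complex mat \<Rightarrow> complex mat \<Rightarrow> bool" (infix "\<simeq>" 50) where
  "A \<simeq> B \<longleftrightarrow> (\<exists>c. cmod c = 1 \<and> A = c \<cdot>\<^sub>m B)"

lemma phase_eqI: "cmod c = 1 \<Longrightarrow> A = c \<cdot>\<^sub>m B \<Longrightarrow> A \<simeq> B"
  by (auto simp: phase_eq_def)

lemma phase_eq_refl [simp]: "A \<simeq> A"
  by (rule phase_eqI[of 1]) auto

lemma phase_eq_sym: "A \<simeq> B \<Longrightarrow> B \<simeq> A"
  unfolding phase_eq_def
proof (elim exE conjE)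
  fix c assume c: "cmod c = 1" "A = c \<cdot>\<^sub>m B"
  then have "c \<noteq> 0" by auto
  with c show "\<exists>c. cmod c = 1 \<and> B = c \<cdot>\<^sub>m A"
    by (intro exI[of _ "inverse c"]) (simp add: smult_smult_mat norm_inverse)
qed

lemma phase_eq_trans [trans]: "A \<simeq> B \<Longrightarrow> B \<simeq> C \<Longrightarrow> A \<simeq> C"
  unfolding phase_eq_def by (metis smult_smult_mat norm_mult mult_1_right)

lemma phase_eq_mult:
  "A \<simeq> A' \<Longrightarrow> B \<simeq> B' \<Longrightarrow> A' \<in> carrier_mat n m \<Longrightarrow> B' \<in> carrier_mat m l \<Longrightarrow> A * B \<simeq> A' * B'"
  unfolding phase_eq_def by (metis smult_mult_smult norm_mult mult_1_right)

lemma phase_eq_kron: "A \<simeq> A' \<Longrightarrow> B \<simeq> B' \<Longrightarrow> A \<otimes>\<^sub>K B \<simeq> A' \<otimes>\<^sub>K B'"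
  unfolding phase_eq_def by (metis kron_smult smult_smult_mat norm_mult mult_1_right)

lemma phase_eq_adjoint: "A \<simeq> B \<Longrightarrow> mat_adjoint A \<simeq> mat_adjoint B"
  unfolding phase_eq_def by (metis mat_adjoint_smult complex_mod_cnj)

lemma mat_adjoint_pauli: "mat_adjoint (pauli n v) \<simeq> pauli n (\<lambda>i. - v i)"
proof (induction n)
  case 0
  show ?case by (simp add: mat_adjoint_one)
next
  case (Suc n)
  then show ?case
    by (auto simp: mat_adjoint_kron intro!: phase_eq_kron phase_eqI[OF _ mat_adjoint_pauli1])
qed

lemma phase_eq_on_factor: "A \<simeq> B \<Longrightarrow> on_factor n i A \<simeq> on_factor n i B"
  by (auto simp: phase_eq_def on_factor_smult)

text \<open>With the phase built in, relations that hold only up to phase suffice to prove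
  membership.\<close>

definition gate_products :: "nat \<Rightarrow> complex mat set" where
  "gate_products n = {c \<cdot>\<^sub>m foldr (*) gs (1\<^sub>m (4 ^ n)) | c gs. cmod c = 1 \<and> set gs \<subseteq> elementary_gates n}"

lemma gates_unitary: "S_gate \<in> unitaries 4" "T_gate \<in> unitaries 4" "Z_gate \<in> unitaries 4" "CZ_gate \<in> unitaries 16"
  using T_gate_unitary unitaries_pauli1[of "(0, 1)"]
  by (auto simp: S_gate_diag CZ_gate_diag pauli1_Z unitaries_iff[of T_gate] intro!: unitaries_diag)

lemma elementary_gates_unitary: "elementary_gates n \<subseteq> unitaries (4 ^ n)"
  using gates_unitary
  by (auto simp: elementary_gates_def intro!: unitaries_on_factor unitaries_on_factors_from)

lemma foldr_gates_unitary:
  "set gs \<subseteq> elementary_gates n \<Longrightarrow> foldr (*) gs (1\<^sub>m (4 ^ n)) \<in> unitaries (4 ^ n)"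
  using elementary_gates_unitary[of n] by (induction gs) (auto intro!: unitaries_mult unitaries_one)

lemma gate_products_unitary: "g \<in> gate_products n \<Longrightarrow> g \<in> unitaries (4 ^ n)"
  by (auto simp: gate_products_def intro!: unitaries_smult foldr_gates_unitary)

lemma gate_products_carrier: "g \<in> gate_products n \<Longrightarrow> g \<in> carrier_mat (4 ^ n) (4 ^ n)"
  by (auto dest: gate_products_unitary)

lemma gate_products_mult: "g \<in> gate_products n \<Longrightarrow> h \<in> gate_products n \<Longrightarrow> g * h \<in> gate_products n"
proof -
  assume "g \<in> gate_products n" "h \<in> gate_products n"
  then obtain c gs d hs where g: "g = c \<cdot>\<^sub>m foldr (*) gs (1\<^sub>m (4 ^ n))" "cmod c = 1" "set gs \<subseteq> elementary_gates n"
    and h: "h = d \<cdot>\<^sub>m foldr (*) hs (1\<^sub>m (4 ^ n))" "cmod d = 1" "set hs \<subseteq> elementary_gates n"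
    unfolding gate_products_def by blast
  have cg: "foldr (*) gs (1\<^sub>m (4 ^ n)) \<in> carrier_mat (4 ^ n) (4 ^ n)" if "set gs \<subseteq> elementary_gates n" for gs
    using foldr_gates_unitary[OF that] by auto
  have "foldr (*) (gs @ hs) (1\<^sub>m (4 ^ n)) = foldr (*) gs (1\<^sub>m (4 ^ n)) * foldr (*) hs (1\<^sub>m (4 ^ n))"
    using g(3)
  proof (induction gs)
    case Nil
    then show ?case using cg[OF h(3)] by simp
  next
    case (Cons a gs)
    have "a \<in> carrier_mat (4 ^ n) (4 ^ n)" using Cons.prems elementary_gates_unitary[of n] by auto
    then show ?case using Cons cg[of gs] cg[OF h(3)] by (simp add: assoc_mult_mat[of _ "4 ^ n" "4 ^ n" _ "4 ^ n" _ "4 ^ n"])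
  qed
  then have "g * h = (c * d) \<cdot>\<^sub>m foldr (*) (gs @ hs) (1\<^sub>m (4 ^ n))"
    unfolding g(1) h(1) smult_mult_smult[OF cg[OF g(3)] cg[OF h(3)]] by simp
  moreover have "cmod (c * d) = 1" "set (gs @ hs) \<subseteq> elementary_gates n"
    using g h by (auto simp: norm_mult)
  ultimately show ?thesis unfolding gate_products_def by blast
qed

lemma gate_products_gate: "g \<in> elementary_gates n \<Longrightarrow> g \<in> gate_products n"
proof -
  assume g: "g \<in> elementary_gates n"
  then have "g = 1 \<cdot>\<^sub>m foldr (*) [g] (1\<^sub>m (4 ^ n))"
    using elementary_gates_unitary[of n] right_mult_one_mat[of g "4 ^ n" "4 ^ n"]
    by (auto dest!: unitaries_carrier)
  with g show ?thesis unfolding gate_products_def by (intro CollectI exI[of _ 1] exI[of _ "[g]"]) auto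
qed

lemma gate_products_one: "1\<^sub>m (4 ^ n) \<in> gate_products n"
  unfolding gate_products_def by (intro CollectI exI[of _ 1] exI[of _ "[]"]) auto

lemma gate_products_phase: "g \<in> gate_products n" if "g \<simeq> h" "h \<in> gate_products n"
proof -
  from that obtain c d gs where "g = (c * d) \<cdot>\<^sub>m foldr (*) gs (1\<^sub>m (4 ^ n))" "cmod (c * d) = 1" "set gs \<subseteq> elementary_gates n"
    unfolding gate_products_def phase_eq_def by (auto simp: smult_smult_mat norm_mult)
  then show ?thesis unfolding gate_products_def by blast
qed

section \<open>The action on Pauli operators\<close>

text \<open>Conjugation by \<open>M\<close>, written without an inverse so that multiplying by gates
  on the left composes directly.\<close>

definition maps_pauli :: "nat \<Rightarrow> complex mat \<Rightarrow> (nat \<Rightarrow> z4 \<times> z4) \<Rightarrow> (nat \<Rightarrow> z4 \<times> z4) \<Rightarrow> bool" where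
  "maps_pauli n M v w \<longleftrightarrow> M * pauli n v \<simeq> pauli n w * M"

lemma maps_pauli_comp:
  assumes "maps_pauli n M v w" "maps_pauli n g w x"
    and "M \<in> carrier_mat (4 ^ n) (4 ^ n)" "g \<in> carrier_mat (4 ^ n) (4 ^ n)"
  shows "maps_pauli n (g * M) v x"
proof -
  note assoc = assoc_mult_mat[of _ "4 ^ n" "4 ^ n" _ "4 ^ n" _ "4 ^ n"]
  have "g * M * pauli n v = g * (M * pauli n v)" using assms by (simp add: assoc)
  also have "g * (M * pauli n v) \<simeq> g * (pauli n w * M)"
    using assms unfolding maps_pauli_def
    by (intro phase_eq_mult[OF phase_eq_refl, of _ _ _ "4 ^ n" "4 ^ n" "4 ^ n"]) auto
  also have "g * (pauli n w * M) = (g * pauli n w) * M" using assms by (simp add: assoc)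
  also have "(g * pauli n w) * M \<simeq> (pauli n x * g) * M"
    using assms unfolding maps_pauli_def
    by (intro phase_eq_mult[OF _ phase_eq_refl, of _ _ "4 ^ n" "4 ^ n" _ "4 ^ n"]) auto
  also have "(pauli n x * g) * M = pauli n x * (g * M)" using assms by (simp add: assoc)
  finally show ?thesis unfolding maps_pauli_def .
qed

text \<open>Compare the two orders of the product of the images: the global phases cancel.\<close>

lemma maps_pauli_symp:
  assumes M: "M \<in> unitaries (4 ^ n)" and vw: "maps_pauli n M v v'" "maps_pauli n M w w'"
  shows "symp n v w = symp n v' w'"
proof -
  have Mc: "M \<in> carrier_mat (4 ^ n) (4 ^ n)" using M by auto
  note assoc = assoc_mult_mat[of _ "4 ^ n" "4 ^ n" _ "4 ^ n" _ "4 ^ n"]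
  note sc = mult_carrier_mat[of _ "4 ^ n" "4 ^ n" _ "4 ^ n"] mult_smult_distrib[of _ "4 ^ n" "4 ^ n" _ "4 ^ n"] mult_smult_assoc_mat[of _ "4 ^ n" "4 ^ n" _ "4 ^ n"]
  obtain c d where c: "cmod c = 1" "M * pauli n v = c \<cdot>\<^sub>m (pauli n v' * M)"
    and d: "cmod d = 1" "M * pauli n w = d \<cdot>\<^sub>m (pauli n w' * M)"
    using vw unfolding maps_pauli_def phase_eq_def by blast
  have image: "M * (pauli n x * pauli n y) = (a * b) \<cdot>\<^sub>m (pauli n x' * pauli n y' * M)"
    if x: "M * pauli n x = a \<cdot>\<^sub>m (pauli n x' * M)" and y: "M * pauli n y = b \<cdot>\<^sub>m (pauli n y' * M)"
    for x y x' y' a b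
  proof -
    have "M * (pauli n x * pauli n y) = M * pauli n x * pauli n y" using Mc by (simp add: assoc)
    also have "\<dots> = a \<cdot>\<^sub>m (pauli n x' * (M * pauli n y))" unfolding x using Mc by (simp add: assoc sc)
    also have "\<dots> = (a * b) \<cdot>\<^sub>m (pauli n x' * pauli n y' * M)"
      unfolding y using Mc by (simp add: assoc sc smult_smult_mat)
    finally show ?thesis .
  qed
  have "(c * d * ipow (symp n v' w')) \<cdot>\<^sub>m (pauli n w' * pauli n v' * M) = M * (pauli n v * pauli n w)"
    unfolding image[OF c(2) d(2)] pauli_commute[of n v' w'] using Mc by (simp add: sc smult_smult_mat)
  also have "\<dots> = (c * d * ipow (symp n v w)) \<cdot>\<^sub>m (pauli n w' * pauli n v' * M)"
    unfolding pauli_commute[of n v w] using Mc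
    by (simp add: sc smult_smult_mat image[OF d(2) c(2)] mult_ac)
  finally have "c * d * ipow (symp n v' w') = c * d * ipow (symp n v w)"
    by (rule unitaries_scalar_eq) (auto intro!: unitaries_mult unitaries_pauli M)
  moreover have "c \<noteq> 0" "d \<noteq> 0" using c(1) d(1) by auto
  ultimately show ?thesis by (simp add: ipow_inj)
qed

text \<open>The last two conditions say that the circuit does not touch the first \<open>k - 1\<close> factors, so that it
  preserves what has already been achieved there.\<close>

definition moves :: "nat \<Rightarrow> nat \<Rightarrow> ((nat \<Rightarrow> z4 \<times> z4) \<Rightarrow> nat \<Rightarrow> z4 \<times> z4) set" where
  "moves k n = {\<phi>. (\<exists>g\<in>gate_products n. \<forall>v. maps_pauli n g v (\<phi> v)) \<and>
     (\<forall>v i. i < k \<longrightarrow> \<phi> v i = v i) \<and> (\<forall>v. (\<forall>i\<ge>k. v i = 0) \<longrightarrow> \<phi> v = v)}"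

lemma moves_id: "id \<in> moves k n"
  unfolding moves_def
  by (auto simp: maps_pauli_def intro!: bexI[OF _ gate_products_one])

lemma moves_comp: "\<phi> \<circ> \<psi> \<in> moves k n" if \<phi>: "\<phi> \<in> moves k n" and \<psi>: "\<psi> \<in> moves k n"
proof -
  obtain g h where "g \<in> gate_products n" "h \<in> gate_products n"
    "\<And>v. maps_pauli n g v (\<phi> v)" "\<And>v. maps_pauli n h v (\<psi> v)"
    using \<phi> \<psi> unfolding moves_def by blast
  then have "g * h \<in> gate_products n" "\<forall>v. maps_pauli n (g * h) v ((\<phi> \<circ> \<psi>) v)"
    by (auto intro!: gate_products_mult maps_pauli_comp gate_products_carrier)
  then show ?thesis using \<phi> \<psi> unfolding moves_def by auto
qed

lemma moves_mono: "k \<le> l \<Longrightarrow> moves l n \<subseteq> moves k n"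
  by (auto simp: moves_def)

text \<open>Iterating at most three times exhausts Z/4, so every multiple, the negative ones
  included, arises from positive powers of a gate.\<close>

lemma moves_iterate:
  assumes "f 0 = id" "\<And>x. f (x + 1) = f 1 \<circ> f x" "f 1 \<in> moves k n"
  shows "f (m :: z4) \<in> moves k n"
proof -
  have step: "f (x + 1) \<in> moves k n" if "f x \<in> moves k n" for x
    unfolding assms(2) using assms(3) that by (rule moves_comp)
  have "f 0 \<in> moves k n" using assms(1) moves_id by simp
  with step[of 0] step[of 1] step[of 2] show ?thesis
    by (cases m rule: z4_cases) simp_all
qed

lemma moves_S:
  assumes "1 \<le> k" "k \<le> i" "i \<le> n"
  shows "(\<lambda>v. v(i := (fst (v i), snd (v i) + m * fst (v i)))) \<in> moves k n" (is "?f m \<in> _")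
proof (rule moves_iterate[where f = ?f])
  let ?g = "on_factor n i S_gate"
  have "?g \<in> gate_products n"
    using assms by (intro gate_products_gate) (auto simp: elementary_gates_def)
  moreover have "maps_pauli n ?g v (?f 1 v)" for v
    unfolding maps_pauli_def
    by (rule phase_eqI[OF norm_s_phase[of "fst (v i)"]], rule on_factor_pauli)
      (use assms gates_unitary S_gate_pauli1[of "fst (v i)" "snd (v i)"] in auto)
  ultimately show "?f 1 \<in> moves k n"
    using assms unfolding moves_def by (auto simp: fun_eq_iff prod_eq_iff)
qed (simp_all add: fun_eq_iff distrib_right add.assoc diff_diff_eq)

lemma moves_T:
  assumes "1 \<le> k" "k \<le> i" "i \<le> n"
  shows "(\<lambda>v. v(i := (fst (v i) - m * snd (v i), snd (v i)))) \<in> moves k n" (is "?f m \<in> _")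
proof (rule moves_iterate[where f = ?f])
  let ?g = "on_factor n i T_gate"
  have "?g \<in> gate_products n"
    using assms by (intro gate_products_gate) (auto simp: elementary_gates_def)
  moreover have "maps_pauli n ?g v (?f 1 v)" for v
    unfolding maps_pauli_def
    by (rule phase_eqI[of "cnj (s_phase (snd (v i)))"], simp, rule on_factor_pauli)
      (use assms gates_unitary T_gate_pauli1[of "fst (v i)" "snd (v i)"] in auto)
  ultimately show "?f 1 \<in> moves k n"
    using assms unfolding moves_def by (auto simp: fun_eq_iff prod_eq_iff)
qed (simp_all add: fun_eq_iff distrib_right add.assoc diff_diff_eq)

lemma moves_CZ:
  assumes "1 \<le> k" "k \<le> i" "Suc i \<le> n"
  shows "(\<lambda>v. v(i := (fst (v i), snd (v i) + m * fst (v (Suc i))),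
      Suc i := (fst (v (Suc i)), snd (v (Suc i)) + m * fst (v i)))) \<in> moves k n" (is "?f m \<in> _")
proof (rule moves_iterate[where f = ?f])
  let ?g = "on_factors_from n i CZ_gate"
  have "?g \<in> gate_products n"
    using assms by (intro gate_products_gate) (auto simp: elementary_gates_def)
  moreover have "maps_pauli n ?g v (?f 1 v)" for v
    unfolding maps_pauli_def
    by (rule phase_eqI[of "ipow (fst (v i) * fst (v (Suc i)))"], simp, rule on_factors_from_pauli)
      (use assms gates_unitary CZ_gate_pauli1[of "fst (v i)" "snd (v i)" "fst (v (Suc i))" "snd (v (Suc i))"] in auto)
  ultimately show "?f 1 \<in> moves k n"
    using assms unfolding moves_def by (auto simp: fun_eq_iff prod_eq_iff)
qed (simp_all add: fun_eq_iff distrib_right add.assoc diff_diff_eq)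

section \<open>Orbits of a single vector under the moves\<close>

definition reach :: "nat \<Rightarrow> nat \<Rightarrow> (nat \<Rightarrow> z4 \<times> z4) \<Rightarrow> (nat \<Rightarrow> z4 \<times> z4) \<Rightarrow> bool" where
  "reach k n v w \<longleftrightarrow> (\<exists>\<phi>\<in>moves k n. \<phi> v = w)"

lemma reach_refl: "reach k n v v"
  unfolding reach_def using moves_id by (auto intro!: bexI[of _ id])

lemma reach_trans [trans]: "reach k n u v \<Longrightarrow> reach k n v w \<Longrightarrow> reach k n u w"
  unfolding reach_def using moves_comp by (metis comp_apply)

lemma reach_S:
  assumes "v i = (a, b)" "1 \<le> k" "k \<le> i" "i \<le> n"
  shows "reach k n v (v(i := (a, b + m * a)))"
  unfolding reach_def by (rule bexI[OF _ moves_S[OF assms(2-4), of m]]) (simp add: assms(1))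

lemma reach_T:
  assumes "v i = (a, b)" "1 \<le> k" "k \<le> i" "i \<le> n"
  shows "reach k n v (v(i := (a - m * b, b)))"
  unfolding reach_def by (rule bexI[OF _ moves_T[OF assms(2-4), of m]]) (simp add: assms(1))

lemma reach_CZ:
  assumes "v i = (a, b)" "v (Suc i) = (a', b')" "1 \<le> k" "k \<le> i" "Suc i \<le> n"
  shows "reach k n v (v(i := (a, b + m * a'), Suc i := (a', b' + m * a)))"
  unfolding reach_def by (rule bexI[OF _ moves_CZ[OF assms(3-5), of m]]) (simp add: assms(1,2))

lemma ex_z4: "(\<exists>x :: z4. P x) \<longleftrightarrow> P 0 \<or> P 1 \<or> P 2 \<or> P 3"
  by (metis z4_exhaust)

text \<open>The powers of \<open>S\<close> and \<open>T\<close> are shears of \<open>(a, b)\<close>.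
  They carry every vector with an odd entry to \<open>(0, 1)\<close>, and otherwise leave only the
  distinction between \<open>2\<close> and \<open>0\<close>.\<close>

lemma reach_normal_form:
  assumes ki: "1 \<le> k" "k \<le> i" "i \<le> n"
  shows "\<exists>d\<in>{0, 1, 2}. reach k n v (v(i := (0, d)))"
proof -
  obtain a b where v: "v i = (a, b)" by fastforce
  \<comment> \<open>\<open>l\<close> makes the first entry odd if either entry is odd, and otherwise
    leads to \<open>(0, 0)\<close>, \<open>(0, 2)\<close> or \<open>(2, 0)\<close>. An odd
    \<open>u\<close> satisfies \<open>u * u = 1\<close>, so \<open>m = (1 - b) * u\<close> turns the
    second entry into \<open>1\<close> and \<open>p = u\<close> clears the first. For
    \<open>(2, 0)\<close> the choice \<open>m = p = 1\<close> passes through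
    \<open>(2, 2)\<close>.\<close>
  define l :: z4 where "l = (if a = 1 \<or> a = 3 \<or> b = 0 \<or> a = 0 \<and> b = 2 then 0 else 1)"
  define m where "m = (if a - l * b = 2 then 1 else (1 - b) * (a - l * b))"
  define p where "p = (if a - l * b = 2 then 1 else a - l * b)"
  have lmp: "a - l * b - p * (b + m * (a - l * b)) = 0" "b + m * (a - l * b) \<in> {0, 1, 2}"
    unfolding p_def m_def l_def
    by (cases a rule: z4_cases; cases b rule: z4_cases; simp)+
  have "reach k n v (v(i := (a - l * b, b)))" by (rule reach_T[of v i a b k n, OF v ki])
  also have "reach k n \<dots> (v(i := (a - l * b, b + m * (a - l * b))))"
    using reach_S[OF _ ki, of "v(i := (a - l * b, b))" "a - l * b" b m] by simp
  also have "reach k n \<dots> (v(i := (0, b + m * (a - l * b))))"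
    using reach_T[OF _ ki, of "v(i := (a - l * b, b + m * (a - l * b)))" "a - l * b" "b + m * (a - l * b)" p]
    by (simp add: lmp(1))
  finally show ?thesis using lmp(2) by blast
qed

lemma z4_triple: "- (3 * d) = d" "d + 3 * d = 0" for d :: z4
  by (cases d rule: z4_cases; simp)+

text \<open>As one entry is zero, two shears through \<open>(d, d)\<close> move the other across
  without a change of sign. The exponent \<open>3\<close> stands for \<open>-1\<close>.\<close>

lemma reach_swap:
  assumes ki: "1 \<le> k" "k \<le> i" "i \<le> n"
  shows "reach k n (v(i := (0, d))) (v(i := (d, 0)))" "reach k n (v(i := (d, 0))) (v(i := (0, d)))"
proof -
  have "reach k n (v(i := (0, d))) (v(i := (d, d)))"
    using reach_T[OF _ ki, of "v(i := (0, d))" 0 d 3] by (simp add: z4_triple)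
  also have "reach k n \<dots> (v(i := (d, 0)))"
    using reach_S[OF _ ki, of "v(i := (d, d))" d d 3] by (simp add: z4_triple)
  finally show "reach k n (v(i := (0, d))) (v(i := (d, 0)))" .
  have "reach k n (v(i := (d, 0))) (v(i := (d, d)))"
    using reach_S[OF _ ki, of "v(i := (d, 0))" d 0 1] by simp
  also have "reach k n \<dots> (v(i := (0, d)))"
    using reach_T[OF _ ki, of "v(i := (d, d))" d d 1] by simp
  finally show "reach k n (v(i := (d, 0))) (v(i := (0, d)))" .
qed

text \<open>One of two elements of \<open>\<int>/4\<close> divides the other, so a power of \<open>C\<^sub>Z\<close> clears one of the two factors.\<close>

lemma reach_pair:
  assumes k: "1 \<le> k" "k \<le> i" "Suc i \<le> n"
  shows "\<exists>p. reach k n v (v(i := p, Suc i := 0))"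
proof -
  have i: "k \<le> i" "i \<le> n" "k \<le> Suc i" "Suc i \<le> n" using k by auto
  note ri = \<open>1 \<le> k\<close> i(1,2) and rj = \<open>1 \<le> k\<close> i(3,4)
  obtain d where d: "d \<in> {0, 1, 2}" "reach k n v (v(i := (0, d)))"
    using reach_normal_form[OF ri] by blast
  obtain e where e: "e \<in> {0, 1, 2}" "reach k n (v(i := (0, d))) (v(i := (0, d), Suc i := (0, e)))"
    using reach_normal_form[OF rj] by blast
  \<comment> \<open>\<open>C_Z\<close> acts through \<open>X\<close> exponents, so factor
    \<open>i\<close> is swapped first. Its exponent \<open>- m\<close> then cancels
    \<open>m * x\<close> in the neighbour, whose own \<open>X\<close> exponent \<open>0\<close>
    leaves factor \<open>i\<close> alone.\<close>
  have kill: "reach k n (v(i := (0, x), Suc i := (0, m * x))) (v(i := (x, 0), Suc i := 0))" for x m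
  proof -
    have "reach k n (v(i := (0, x), Suc i := (0, m * x))) (v(i := (x, 0), Suc i := (0, m * x)))"
      using reach_swap(1)[OF ri, of "v(Suc i := (0, m * x))" x] by (simp add: fun_upd_twist)
    also have "reach k n \<dots> (v(i := (x, 0), Suc i := 0))"
      using reach_CZ[OF _ _ k, of "v(i := (x, 0), Suc i := (0, m * x))" x 0 0 "m * x" "- m"]
      by (simp add: zero_prod_def fun_upd_twist)
    finally show ?thesis .
  qed
  obtain x m where "reach k n (v(i := (0, d), Suc i := (0, e))) (v(i := (0, x), Suc i := (0, m * x)))"
  proof -
    have "\<exists>x m. reach k n (v(i := (0, d), Suc i := (0, e))) (v(i := (0, x), Suc i := (0, m * x)))"
    proof (cases "\<exists>m. e = m * d")
      case True
      then show ?thesis using reach_refl by blast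
    next
      case False
      \<comment> \<open>Either \<open>d = 0\<close>, or \<open>d = 2\<close> and
        \<open>e = 1\<close>. In both cases \<open>e - d\<close> is a multiple of \<open>e\<close>,
        so \<open>C_Z\<close> can replace \<open>d\<close> by \<open>e\<close>, after which the two
        entries agree.\<close>
      have "\<exists>m. e = d + m * e" using d(1) e(1) False unfolding ex_z4 by auto
      then obtain m where m: "e = d + m * e" by blast
      have "reach k n (v(i := (0, d), Suc i := (0, e))) (v(i := (0, d), Suc i := (e, 0)))"
        using reach_swap(1)[OF rj, of "v(i := (0, d))" e] by simp
      also have "reach k n \<dots> (v(i := (0, e), Suc i := (e, 0)))"
        using reach_CZ[OF _ _ k, of "v(i := (0, d), Suc i := (e, 0))" 0 d e 0 m]
        by (simp add: m[symmetric] fun_upd_twist)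
      also have "reach k n \<dots> (v(i := (0, e), Suc i := (0, 1 * e)))"
        using reach_swap(2)[OF rj, of "v(i := (0, e))" e] by simp
      finally show ?thesis by blast
    qed
    with that show thesis by blast
  qed
  from reach_trans[OF d(2) reach_trans[OF e(2) reach_trans[OF this kill]]] show ?thesis by blast
qed

lemma reach_factor:
  assumes "1 \<le> k" "k \<le> n"
  shows "\<exists>w d. d \<in> {0, 1, 2} \<and> reach k n v w \<and> w k = (0, d) \<and> (\<forall>i. k < i \<and> i \<le> n \<longrightarrow> w i = 0)"
proof -
  \<comment> \<open>The last possibly nonzero factor \<open>m\<close> descends from \<open>n\<close>
    to \<open>k\<close>, each pair pushing what remains into its left member.\<close>
  have "\<exists>w. reach k n v w \<and> (\<forall>i. m < i \<and> i \<le> n \<longrightarrow> w i = 0)" if "m \<le> n" "k \<le> m" for m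
    using that
  proof (induction m rule: inc_induct)
    case base
    then show ?case by (intro exI[of _ v]) (auto simp: reach_refl)
  next
    case (step m)
    then obtain w where w: "reach k n v w" "\<forall>i. Suc m < i \<and> i \<le> n \<longrightarrow> w i = 0" by auto
    obtain p where p: "reach k n w (w(m := p, Suc m := 0))"
      using reach_pair[of k m n w] assms step by auto
    with w show ?case
      by (intro exI[of _ "w(m := p, Suc m := 0)"] conjI reach_trans[OF w(1) p]) auto
  qed
  then obtain w where w: "reach k n v w" "\<forall>i. k < i \<and> i \<le> n \<longrightarrow> w i = 0"
    using assms by blast
  obtain d where d: "d \<in> {0, 1, 2}" "reach k n w (w(k := (0, d)))"
    using reach_normal_form[of k k n w] assms by auto
  with w show ?thesis
    by (intro exI[of _ "w(k := (0, d))"] exI[of _ d] conjI reach_trans[OF w(1) d(2)]) auto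
qed

section \<open>Reduction of Clifford operators\<close>

lemma moves_maps_pauli:
  assumes "\<phi> \<in> moves k n"
  obtains g where "g \<in> gate_products n"
    "\<And>M v w. M \<in> carrier_mat (4 ^ n) (4 ^ n) \<Longrightarrow> maps_pauli n M v w \<Longrightarrow> maps_pauli n (g * M) v (\<phi> w)"
proof -
  from assms obtain g where "g \<in> gate_products n" "\<And>v. maps_pauli n g v (\<phi> v)"
    unfolding moves_def by blast
  with that[of g] show thesis by (auto intro: maps_pauli_comp gate_products_carrier)
qed

lemma moves_single: "\<phi> (single j p) = single j p" if "\<phi> \<in> moves k n" "j < k"
  using that unfolding moves_def by auto

lemma maps_pauli_cong:
  "maps_pauli n M v w" if "maps_pauli n M v w'" "\<And>i. 1 \<le> i \<Longrightarrow> i \<le> n \<Longrightarrow> w' i = w i"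
  using that(1) pauli_cong[of n w' w] that(2) by (simp add: maps_pauli_def)

text \<open>One circuit must act on two vectors, so the move itself is produced and not just
  reachability. The gates touching factor \<open>k\<close> are powers of \<open>C_Z\<close> and
  \<open>S\<close>; these are diagonal and so keep \<open>Z_k\<close>, while the entry
  \<open>1\<close> of \<open>w k\<close> serves as pivot.\<close>

lemma moves_clear_X:
  assumes k: "1 \<le> k" "k \<le> n" and w: "fst (w k) = 1"
  obtains \<phi> where "\<phi> \<in> moves k n" "\<phi> w k = (1, 0)" "\<And>i. k < i \<Longrightarrow> i \<le> n \<Longrightarrow> \<phi> w i = 0"
    "\<phi> (single k (0, 1)) = single k (0, 1)"
proof -
  have "\<exists>\<phi>\<in>moves k n. fst (\<phi> w k) = 1 \<and> (\<forall>i. k < i \<and> i \<le> n \<longrightarrow> \<phi> w i = 0) \<and>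
      \<phi> (single k (0, 1)) = single k (0, 1)"
  proof (cases "k = n")
    case True
    then show ?thesis using w by (intro bexI[OF _ moves_id]) auto
  next
    case False
    then have k': "Suc k \<le> n" using k by simp
    obtain \<psi> e where \<psi>: "\<psi> \<in> moves (Suc k) n" "\<psi> w (Suc k) = (0, e)"
      "\<And>i. Suc k < i \<Longrightarrow> i \<le> n \<Longrightarrow> \<psi> w i = 0"
      using reach_factor[of "Suc k" n w] k k' unfolding reach_def by auto
    have \<psi>k: "\<psi> w k = w k" using \<psi>(1) by (simp add: moves_def)
    \<comment> \<open>The \<open>X\<close> exponent \<open>1\<close> at \<open>k\<close> turns the
      multiplier \<open>- e\<close> into the cancellation of \<open>e\<close>, and the
      \<open>X\<close> exponent \<open>0\<close> at \<open>Suc k\<close> leaves factor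
      \<open>k\<close> unchanged.\<close>
    let ?c = "\<lambda>v :: nat \<Rightarrow> z4 \<times> z4. v(k := (fst (v k), snd (v k) + (- e) * fst (v (Suc k))),
      Suc k := (fst (v (Suc k)), snd (v (Suc k)) + (- e) * fst (v k)))"
    have c: "?c \<in> moves k n" by (rule moves_CZ[OF k(1) order_refl k'])
    have "?c \<circ> \<psi> \<in> moves k n"
      using moves_comp[OF c] \<psi>(1) moves_mono[of k "Suc k" n] by auto
    moreover have "?c (single k (0, 1)) = single k (0, 1)"
      by (auto simp: fun_eq_iff single_def prod_eq_iff)
    moreover have "fst ((?c \<circ> \<psi>) w k) = 1" using \<psi>k w by simp
    moreover have "(?c \<circ> \<psi>) w i = 0" if "k < i" "i \<le> n" for i
    proof (cases "i = Suc k")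
      case True
      then show ?thesis using \<psi>(2) \<psi>k w by (simp add: prod_eq_iff)
    next
      case False
      then show ?thesis using \<psi>(3)[of i] that by simp
    qed
    moreover have "\<psi> (single k (0, 1)) = single k (0, 1)"
      using moves_single[OF \<psi>(1)] by simp
    ultimately show ?thesis by (intro bexI[of _ "?c \<circ> \<psi>"]) (simp_all del: fun_upd_apply)
  qed
  then obtain \<phi> where \<phi>: "\<phi> \<in> moves k n" "fst (\<phi> w k) = 1" "\<And>i. k < i \<Longrightarrow> i \<le> n \<Longrightarrow> \<phi> w i = 0"
      "\<phi> (single k (0, 1)) = single k (0, 1)" by blast
  let ?s = "\<lambda>v :: nat \<Rightarrow> z4 \<times> z4. v(k := (fst (v k), snd (v k) + (- snd (\<phi> w k)) * fst (v k)))"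
  have "?s \<circ> \<phi> \<in> moves k n"
    by (rule moves_comp[OF moves_S[OF k(1) order_refl k(2)] \<phi>(1)])
  moreover have "?s (single k (0, 1)) = single k (0, 1)"
    by (auto simp: fun_eq_iff single_def)
  ultimately show thesis using that[of "?s \<circ> \<phi>"] \<phi> by auto
qed

definition fixes_factor :: "nat \<Rightarrow> complex mat \<Rightarrow> nat \<Rightarrow> bool" where
  "fixes_factor n M j \<longleftrightarrow> (\<forall>p\<in>{(1, 0), (0, 1)}. maps_pauli n M (single j p) (single j p))"

definition preserves_pauli :: "nat \<Rightarrow> complex mat \<Rightarrow> bool" where
  "preserves_pauli n M \<longleftrightarrow>
     (\<forall>j p. 1 \<le> j \<and> j \<le> n \<and> p \<in> {(1, 0), (0, 1)} \<longrightarrow> (\<exists>w. maps_pauli n M (single j p) w))"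

lemma fixes_factor_move:
  assumes "M \<in> carrier_mat (4 ^ n) (4 ^ n)" "\<phi> \<in> moves k n" "j < k" "fixes_factor n M j"
    and "\<And>v w. maps_pauli n M v w \<Longrightarrow> maps_pauli n (g * M) v (\<phi> w)"
  shows "fixes_factor n (g * M) j"
  using assms(4,5) moves_single[OF assms(2,3)] unfolding fixes_factor_def by metis

text \<open>The image of a Pauli operator on factor \<open>k\<close> commutes with all \<open>X\<close> and \<open>Z\<close> on fixed factors.\<close>

lemma maps_pauli_support:
  assumes "M \<in> unitaries (4 ^ n)" "fixes_factor n M j" "maps_pauli n M (single k p) v"
    and "1 \<le> j" "j \<le> n" "j \<noteq> k"
  shows "v j = 0"
proof -
  have "snd (v j) * fst q - fst (v j) * snd q = 0" if "q \<in> {(1, 0), (0, 1)}" for q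
  proof -
    have "symp n (single k p) (single j q) = symp n v (single j q)"
      using assms that by (intro maps_pauli_symp) (auto simp: fixes_factor_def)
    then show ?thesis using assms(4-6) by (simp add: symp_single_right)
  qed
  from this[of "(1, 0)"] this[of "(0, 1)"] show ?thesis by (simp add: prod_eq_iff)
qed

lemma fix_next_factor:
  assumes M: "M \<in> unitaries (4 ^ n)" and pres: "preserves_pauli n M" and k: "1 \<le> k" "k \<le> n"
    and fixed: "\<And>j. 1 \<le> j \<Longrightarrow> j < k \<Longrightarrow> fixes_factor n M j"
  shows "\<exists>g\<in>gate_products n. preserves_pauli n (g * M) \<and>
    (\<forall>j. 1 \<le> j \<and> j \<le> k \<longrightarrow> fixes_factor n (g * M) j)"
proof -
  obtain v w where v: "maps_pauli n M (single k (0, 1)) v" and w: "maps_pauli n M (single k (1, 0)) w"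
    using pres k unfolding preserves_pauli_def by blast
  obtain \<phi> d where \<phi>: "\<phi> \<in> moves k n" "d \<in> {0, 1, 2}" "\<phi> v k = (0, d)"
    "\<And>i. k < i \<Longrightarrow> i \<le> n \<Longrightarrow> \<phi> v i = 0"
    using reach_factor[OF k, of v] unfolding reach_def by blast
  obtain g where g: "g \<in> gate_products n"
    and gM: "\<And>v w. maps_pauli n M v w \<Longrightarrow> maps_pauli n (g * M) v (\<phi> w)"
    using moves_maps_pauli[OF \<phi>(1)] M by (metis unitaries_carrier)
  define N where "N = g * M"
  have N: "N \<in> unitaries (4 ^ n)"
    unfolding N_def by (intro unitaries_mult gate_products_unitary g M)
  have fixedN: "fixes_factor n N j" if "1 \<le> j" "j < k" for j
    unfolding N_def using M gM fixed[OF that] that(2) \<phi>(1) by (intro fixes_factor_move) auto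
  \<comment> \<open>The sweep controls only the factors from \<open>k\<close> on; the earlier
    entries vanish because those factors are already fixed.\<close>
  have Nv: "maps_pauli n N (single k (0, 1)) (single k (0, d))"
  proof (rule maps_pauli_cong)
    show *: "maps_pauli n N (single k (0, 1)) (\<phi> v)" unfolding N_def by (rule gM[OF v])
    fix i assume "1 \<le> i" "i \<le> n"
    then show "\<phi> v i = single k (0, d) i"
      using maps_pauli_support[OF N fixedN *, of i] \<phi>(3,4) by (cases i k rule: linorder_cases) auto
  qed
  have Nw: "maps_pauli n N (single k (1, 0)) (\<phi> w)" unfolding N_def by (rule gM[OF w])
  \<comment> \<open>The pairing of \<open>Z_k\<close> with \<open>X_k\<close> is \<open>1\<close>,
    hence \<open>d\<close> is a unit. This excludes \<open>0\<close> and \<open>2\<close>, and then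
    the other image has \<open>X\<close> exponent \<open>1\<close> at \<open>k\<close>, the pivot
    for clearing it.\<close>
  have "symp n (single k (0, 1)) (single k (1, 0)) = symp n (single k (0, d)) (\<phi> w)"
    by (rule maps_pauli_symp[OF N Nv Nw])
  then have dw: "d * fst (\<phi> w k) = 1" using k by (simp add: symp_single_left)
  have "d = 1" using dw \<phi>(2) by (cases "fst (\<phi> w k)" rule: z4_cases) auto
  with dw have w1: "fst (\<phi> w k) = 1" by simp
  obtain \<psi> where \<psi>: "\<psi> \<in> moves k n" "\<psi> (\<phi> w) k = (1, 0)"
    "\<And>i. k < i \<Longrightarrow> i \<le> n \<Longrightarrow> \<psi> (\<phi> w) i = 0" "\<psi> (single k (0, 1)) = single k (0, 1)"
    using moves_clear_X[of k n "\<phi> w", OF k w1] by blast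
  obtain h where h: "h \<in> gate_products n"
    and hN: "\<And>v w. maps_pauli n N v w \<Longrightarrow> maps_pauli n (h * N) v (\<psi> w)"
    using moves_maps_pauli[OF \<psi>(1)] N by (metis unitaries_carrier)
  have hNu: "h * N \<in> unitaries (4 ^ n)" by (intro unitaries_mult gate_products_unitary h N)
  have fixed_less: "fixes_factor n (h * N) j" if "1 \<le> j" "j < k" for j
    using N hN fixedN[OF that] that(2) \<psi>(1) by (intro fixes_factor_move) auto
  have "maps_pauli n (h * N) (single k (1, 0)) (single k (1, 0))"
  proof (rule maps_pauli_cong)
    show *: "maps_pauli n (h * N) (single k (1, 0)) (\<psi> (\<phi> w))" by (rule hN[OF Nw])
    fix i assume "1 \<le> i" "i \<le> n"
    then show "\<psi> (\<phi> w) i = single k (1, 0) i"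
      using maps_pauli_support[OF hNu fixed_less *, of i] \<psi>(2,3) by (cases i k rule: linorder_cases) auto
  qed
  moreover have "maps_pauli n (h * N) (single k (0, 1)) (single k (0, 1))"
    using hN[OF Nv] \<psi>(4) \<open>d = 1\<close> by simp
  ultimately have "fixes_factor n (h * N) k" by (simp add: fixes_factor_def)
  with fixed_less have "fixes_factor n (h * N) j" if "1 \<le> j" "j \<le> k" for j
    using that by (cases "j = k") auto
  moreover have "preserves_pauli n (h * N)"
    unfolding preserves_pauli_def
  proof (intro allI impI)
    fix j p assume "1 \<le> j \<and> j \<le> n \<and> p \<in> {(1 :: z4, 0 :: z4), (0, 1)}"
    then obtain w where "maps_pauli n M (single j p) w" using pres unfolding preserves_pauli_def by blast
    from hN[OF gM[OF this, folded N_def]]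
    show "\<exists>w. maps_pauli n (h * N) (single j p) w" by blast
  qed
  moreover have "h * N = (h * g) * M"
    unfolding N_def using M gate_products_carrier[OF g] gate_products_carrier[OF h]
    by (simp add: assoc_mult_mat[of _ "4 ^ n" "4 ^ n" _ "4 ^ n" _ "4 ^ n"] unitaries_carrier)
  ultimately show ?thesis using gate_products_mult[OF h g] by auto
qed

lemma fix_all_factors:
  assumes M: "M \<in> unitaries (4 ^ n)" and pres: "preserves_pauli n M" and "k \<le> n"
  shows "\<exists>g\<in>gate_products n. preserves_pauli n (g * M) \<and>
    (\<forall>j. 1 \<le> j \<and> j \<le> k \<longrightarrow> fixes_factor n (g * M) j)"
  using \<open>k \<le> n\<close>
proof (induction k)
  case 0
  have "1\<^sub>m (4 ^ n) * M = M" using M by auto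
  then show ?case using pres by (intro bexI[OF _ gate_products_one]) auto
next
  case (Suc k)
  then obtain g where g: "g \<in> gate_products n" "preserves_pauli n (g * M)"
    "\<And>j. 1 \<le> j \<Longrightarrow> j \<le> k \<Longrightarrow> fixes_factor n (g * M) j" by auto
  obtain h where h: "h \<in> gate_products n" "preserves_pauli n (h * (g * M))"
    "\<And>j. 1 \<le> j \<Longrightarrow> j \<le> Suc k \<Longrightarrow> fixes_factor n (h * (g * M)) j"
    using fix_next_factor[of "g * M" n "Suc k"] g M Suc.prems
    by (auto intro: unitaries_mult gate_products_unitary)
  moreover have "h * (g * M) = (h * g) * M"
    using M gate_products_carrier[OF g(1)] gate_products_carrier[OF h(1)]
    by (simp add: assoc_mult_mat[of _ "4 ^ n" "4 ^ n" _ "4 ^ n" _ "4 ^ n"] unitaries_carrier)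
  ultimately show ?case using gate_products_mult[OF h(1) g(1)] by auto
qed

section \<open>Pauli operators as products of gates\<close>

lemma on_factor_pauli1_gate_product:
  assumes i: "1 \<le> i" "i \<le> n"
  shows "on_factor n i (pauli1 p) \<in> gate_products n"
proof -
  define G where "G = {A \<in> carrier_mat 4 4. on_factor n i A \<in> gate_products n}"
  have mult: "A * B \<in> G" if "A \<in> G" "B \<in> G" for A B
    using that by (simp add: G_def on_factor_mult gate_products_mult mult_carrier_mat[of _ 4 4])
  have phase: "A \<in> G" if AB: "A \<simeq> B" "B \<in> G" for A B
  proof -
    obtain c where "A = c \<cdot>\<^sub>m B" using AB(1) unfolding phase_eq_def by blast
    then have "A \<in> carrier_mat 4 4" using AB(2) by (simp add: G_def)
    moreover have "on_factor n i A \<in> gate_products n"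
      by (rule gate_products_phase[OF phase_eq_on_factor[OF AB(1)]]) (use AB(2) in \<open>simp add: G_def\<close>)
    ultimately show ?thesis by (simp add: G_def)
  qed
  have "on_factor n i T_gate \<in> gate_products n" "on_factor n i Z_gate \<in> gate_products n"
    using i by (auto intro!: gate_products_gate simp: elementary_gates_def)
  then have T: "T_gate \<in> G" and Z: "pauli1 (0, 1) \<in> G"
    by (simp_all add: G_def flip: pauli1_Z)
  have add: "pauli1 (p + q) \<in> G" if "pauli1 p \<in> G" "pauli1 q \<in> G" for p q
  proof (rule phase)
    show "pauli1 (p + q) \<simeq> pauli1 p * pauli1 q"
      by (rule phase_eq_sym, rule phase_eqI[OF _ pauli1_mult]) simp
  qed (rule mult[OF that])
  define A where "A = T_gate * T_gate"
  \<comment> \<open>The inverse of \<open>T\<close>, bracketed to match \<open>T_gate_power8\<close>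
    after one more factor \<open>T\<close> on the left.\<close>
  define T7 where "T7 = (T_gate * A) * (A * A)"
  note carrier = mult_carrier_mat[of _ 4 4 _ 4] and assoc = assoc_mult_mat[of _ 4 4 _ 4 _ 4]
  have A: "A \<in> G" unfolding A_def by (intro mult T)
  have T7: "T7 \<in> G" unfolding T7_def by (intro mult T A)
  have A4: "A \<in> carrier_mat 4 4" and T74: "T7 \<in> carrier_mat 4 4" using A T7 by (simp_all add: G_def)
  have TT7: "T_gate * T7 = 1\<^sub>m 4"
  proof -
    have "T_gate * T7 = (T_gate * T_gate) * A * (A * A)"
      unfolding T7_def using A4 by (simp add: assoc carrier)
    also have "\<dots> = 1\<^sub>m 4" unfolding A_def by (rule T_gate_power8)
    finally show ?thesis .
  qed
  \<comment> \<open>Conjugation by \<open>T\<close> subtracts the \<open>Z\<close> exponent from the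
    \<open>X\<close> exponent and so creates \<open>X\<close> out of \<open>Z\<close>; here
    \<open>3\<close> is \<open>-1\<close>. Three further factors \<open>Z\<close> then isolate
    \<open>X^3\<close>, which generates all powers of \<open>X\<close>.\<close>
  have "T_gate * pauli1 (0, 1) * T7 = (cnj (s_phase 1) \<cdot>\<^sub>m (pauli1 (3, 1) * T_gate)) * T7"
    by (subst T_gate_pauli1) simp
  also have "\<dots> = cnj (s_phase 1) \<cdot>\<^sub>m ((pauli1 (3, 1) * T_gate) * T7)"
    by (rule mult_smult_assoc_mat[OF carrier[OF pauli1_carrier(1) T_gate_carrier(1)] T74])
  also have "(pauli1 (3, 1) * T_gate) * T7 = pauli1 (3, 1) * (T_gate * T7)"
    by (rule assoc[OF pauli1_carrier(1) T_gate_carrier(1) T74])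
  finally have "T_gate * pauli1 (0, 1) * T7 = cnj (s_phase 1) \<cdot>\<^sub>m (pauli1 (3, 1) * (T_gate * T7))" .
  then have "T_gate * pauli1 (0, 1) * T7 \<simeq> pauli1 (3, 1)"
    unfolding TT7 by (intro phase_eqI[of "cnj (s_phase 1)"]) (simp_all add: right_mult_one_mat[of _ 4 4])
  from phase[OF phase_eq_sym[OF this]] have "pauli1 (3, 1) \<in> G" by (simp add: mult T Z T7)
  from add[OF this Z] have 32: "pauli1 (3, 2) \<in> G" by simp
  from add[OF this Z] have 33: "pauli1 (3, 3) \<in> G" by simp
  from add[OF this Z] have 30: "pauli1 (3, 0) \<in> G" by simp
  from add[OF 30 30] have 20: "pauli1 (2, 0) \<in> G" by simp
  from add[OF 20 30] have 10: "pauli1 (1, 0) \<in> G" by simp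
  from add[OF 10 30] have 00: "pauli1 (0, 0) \<in> G" by simp
  from add[OF Z Z] have 02: "pauli1 (0, 2) \<in> G" by simp
  from add[OF 02 Z] have 03: "pauli1 (0, 3) \<in> G" by simp
  have "pauli1 (a, 0) \<in> G" for a using 00 10 20 30 by (cases a rule: z4_cases) auto
  moreover have "pauli1 (0, b) \<in> G" for b using 00 Z 02 03 by (cases b rule: z4_cases) auto
  ultimately have "pauli1 ((fst p, 0) + (0, snd p)) \<in> G" by (intro add)
  then show ?thesis by (simp add: G_def)
qed

lemma pauli_gate_product: "pauli n u \<in> gate_products n"
proof -
  have "pauli n (\<lambda>i. if i \<le> k then u i else 0) \<in> gate_products n" if "k \<le> n" for k
    using that
  proof (induction k)
    case 0
    have "pauli n (\<lambda>i. if i \<le> 0 then u i else 0) = 1\<^sub>m (4 ^ n)"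
      unfolding pauli_zero[symmetric] by (rule pauli_cong) auto
    then show ?case by (simp only: gate_products_one)
  next
    case (Suc k)
    let ?v = "\<lambda>i. if i \<le> k then u i else 0" and ?s = "single (Suc k) (u (Suc k))"
    have "pauli n (\<lambda>i. if i \<le> Suc k then u i else 0) = pauli n (\<lambda>i. ?v i + ?s i)"
      by (rule pauli_cong) (auto simp: single_def le_Suc_eq)
    also have "\<dots> \<simeq> pauli n ?v * pauli n ?s"
      by (rule phase_eq_sym, rule phase_eqI[OF _ pauli_mult]) simp
    finally have "pauli n (\<lambda>i. if i \<le> Suc k then u i else 0) \<simeq> pauli n ?v * pauli n ?s" .
    moreover have "pauli n ?s \<in> gate_products n"
      using Suc.prems on_factor_pauli1_gate_product[of "Suc k" n "u (Suc k)"] by (simp add: pauli_single)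
    ultimately show ?case
      using Suc gate_products_phase gate_products_mult by (meson Suc_leD)
  qed
  from this[OF order_refl] show ?thesis
    using pauli_cong[of n "\<lambda>i. if i \<le> n then u i else 0" u] by simp
qed

text \<open>The phases of \<open>pauli_mult\<close> vanish because no factor carries both an
  \<open>X\<close> and a \<open>Z\<close> exponent. In contrast, \<open>X Z\<close> has fourth power
  \<open>-1\<close>.\<close>

lemma pauli_single_power4:
  assumes "p \<in> {(1, 0), (0, 1)}"
  shows "(pauli n (single j p) * pauli n (single j p)) * (pauli n (single j p) * pauli n (single j p)) = 1\<^sub>m (4 ^ n)"
proof -
  let ?s = "\<lambda>i. single j p i + single j p i"
  have "snd (single j p i) * fst (single j p i) = 0" "snd (?s i) * fst (?s i) = 0" for i
    using assms by (auto simp: single_def)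
  then have 1: "pauli n (single j p) * pauli n (single j p) = pauli n ?s"
    "pauli n ?s * pauli n ?s = pauli n (\<lambda>i. ?s i + ?s i)"
    by (simp_all add: pauli_mult)
  have "?s i + ?s i = 0" for i
    using assms by (cases "i = j") (auto simp: prod_eq_iff)
  then show ?thesis unfolding 1 by (simp add: pauli_zero)
qed

text \<open>The phase is a fourth root of unity because \<open>X\<close> and \<open>Z\<close> have order \<open>4\<close>.\<close>

lemma maps_pauli_phase:
  assumes M: "M \<in> unitaries (4 ^ n)" and p: "p \<in> {(1, 0), (0, 1)}"
    and fixed: "maps_pauli n M (single j p) (single j p)"
  shows "\<exists>x. M * pauli n (single j p) = ipow x \<cdot>\<^sub>m (pauli n (single j p) * M)"
proof -
  let ?P = "pauli n (single j p)"
  have Mc: "M \<in> carrier_mat (4 ^ n) (4 ^ n)" using M by auto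
  note alg = mult_carrier_mat[of _ "4 ^ n" "4 ^ n" _ "4 ^ n"] assoc_mult_mat[of _ "4 ^ n" "4 ^ n" _ "4 ^ n" _ "4 ^ n"]
    mult_smult_distrib[of _ "4 ^ n" "4 ^ n" _ "4 ^ n"] mult_smult_assoc_mat[of _ "4 ^ n" "4 ^ n" _ "4 ^ n"]
  have square: "M * (A * A) = (c * c) \<cdot>\<^sub>m ((A * A) * M)"
    if A: "A \<in> carrier_mat (4 ^ n) (4 ^ n)" "M * A = c \<cdot>\<^sub>m (A * M)" for A c
  proof -
    have "M * (A * A) = (M * A) * A" using A(1) Mc by (simp add: alg)
    also have "\<dots> = (c \<cdot>\<^sub>m (A * M)) * A" by (simp only: A(2))
    also have "\<dots> = c \<cdot>\<^sub>m (A * (M * A))" using A(1) Mc by (simp add: alg)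
    also have "\<dots> = (c * c) \<cdot>\<^sub>m ((A * A) * M)" unfolding A(2) using A(1) Mc by (simp add: alg smult_smult_mat)
    finally show ?thesis .
  qed
  obtain c where c: "M * ?P = c \<cdot>\<^sub>m (?P * M)"
    using fixed unfolding maps_pauli_def phase_eq_def by blast
  have "M * ((?P * ?P) * (?P * ?P)) = (c * c * (c * c)) \<cdot>\<^sub>m (((?P * ?P) * (?P * ?P)) * M)"
    by (rule square[OF mult_carrier_mat[OF pauli_carrier pauli_carrier] square[OF pauli_carrier c]])
  then have "1 \<cdot>\<^sub>m M = (c * c * (c * c)) \<cdot>\<^sub>m M"
    unfolding pauli_single_power4[OF p] using Mc by simp
  then have "1 = c * c * (c * c)" by (rule unitaries_scalar_eq[OF _ M]) simp
  then have "c ^ 4 = 1" by (simp add: eval_nat_numeral mult.assoc)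
  then obtain x where "c = ipow x" using ipow_surj by blast
  with c show ?thesis by blast
qed

text \<open>The symplectic form is nondegenerate, so some Pauli operator realises any prescribed
  commutation phases with the \<open>X_j\<close> and \<open>Z_j\<close>. Multiplying by it makes
  \<open>M\<close> commute exactly, hence scalar.\<close>

lemma fixes_all_factors_gate_product:
  assumes M: "M \<in> unitaries (4 ^ n)" and fixed: "\<And>j. 1 \<le> j \<Longrightarrow> j \<le> n \<Longrightarrow> fixes_factor n M j"
  shows "\<exists>h\<in>gate_products n. \<exists>c. h * M = c \<cdot>\<^sub>m 1\<^sub>m (4 ^ n)"
proof -
  have Mc: "M \<in> carrier_mat (4 ^ n) (4 ^ n)" using M by auto
  note alg = mult_carrier_mat[of _ "4 ^ n" "4 ^ n" _ "4 ^ n"] assoc_mult_mat[of _ "4 ^ n" "4 ^ n" _ "4 ^ n" _ "4 ^ n"]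
    mult_smult_distrib[of _ "4 ^ n" "4 ^ n" _ "4 ^ n"] mult_smult_assoc_mat[of _ "4 ^ n" "4 ^ n" _ "4 ^ n"]
  define x where "x j p = (SOME x. M * pauli n (single j p) = ipow x \<cdot>\<^sub>m (pauli n (single j p) * M))" for j p
  have x: "M * pauli n (single j p) = ipow (x j p) \<cdot>\<^sub>m (pauli n (single j p) * M)"
    if j: "1 \<le> j" "j \<le> n" and p: "p \<in> {(1, 0), (0, 1)}" for j p
  proof -
    have "maps_pauli n M (single j p) (single j p)" using fixed[OF j] p unfolding fixes_factor_def by blast
    from someI_ex[OF maps_pauli_phase[OF M p this]] show ?thesis unfolding x_def .
  qed
  \<comment> \<open>Pairing \<open>u\<close> with \<open>X_j\<close> gives the second entry of
    \<open>u j\<close>, pairing with \<open>Z_j\<close> gives minus the first. The entries are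
    chosen to cancel both phases.\<close>
  define u where "u j = (x j (0, 1), - x j (1, 0))" for j
  have "pauli n u * M * pauli n (single j p) = pauli n (single j p) * (pauli n u * M)"
    if j: "1 \<le> j" "j \<le> n" and p: "p \<in> {(1, 0), (0, 1)}" for j p
  proof -
    let ?P = "pauli n (single j p)"
    have s: "x j p + symp n u (single j p) = 0"
      using p j by (auto simp: symp_single_right u_def)
    have "pauli n u * M * ?P = pauli n u * (M * ?P)" using Mc by (simp add: alg)
    also have "\<dots> = ipow (x j p) \<cdot>\<^sub>m ((pauli n u * ?P) * M)"
      unfolding x[OF j p] using Mc by (simp add: alg)
    also have "\<dots> = ipow (x j p + symp n u (single j p)) \<cdot>\<^sub>m (?P * (pauli n u * M))"
      unfolding pauli_commute[of n u "single j p"] using Mc by (simp add: alg smult_smult_mat ipow_add)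
    finally show ?thesis by (simp add: s)
  qed
  then have "\<exists>c. pauli n u * M = c \<cdot>\<^sub>m 1\<^sub>m (4 ^ n)"
    by (rule pauli_commutant[OF mult_carrier_mat[OF pauli_carrier Mc]])
  then show ?thesis using pauli_gate_product by blast
qed

lemma preserves_pauli_adjoint_gate_product:
  assumes V: "V \<in> unitaries (4 ^ n)" and pres: "preserves_pauli n (mat_adjoint V)"
  shows "V \<in> gate_products n"
proof -
  let ?U = "mat_adjoint V"
  have Vc: "V \<in> carrier_mat (4 ^ n) (4 ^ n)" "?U \<in> carrier_mat (4 ^ n) (4 ^ n)" "?U * V = 1\<^sub>m (4 ^ n)"
    using V by (auto simp: unitaries_iff)
  have U: "?U \<in> unitaries (4 ^ n)"
    using V Vc(2) by (simp add: unitaries_iff mat_adjoint_adjoint)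
  obtain g where g: "g \<in> gate_products n" "\<And>j. 1 \<le> j \<Longrightarrow> j \<le> n \<Longrightarrow> fixes_factor n (g * ?U) j"
    using fix_all_factors[OF U pres order_refl] by blast
  obtain h c where h: "h \<in> gate_products n" "h * (g * ?U) = c \<cdot>\<^sub>m 1\<^sub>m (4 ^ n)"
    using fixes_all_factors_gate_product[OF unitaries_mult[OF gate_products_unitary[OF g(1)] U] g(2)]
    by blast
  note gc = gate_products_carrier[OF g(1)] and hc = gate_products_carrier[OF h(1)]
  have hg: "h * g = c \<cdot>\<^sub>m V"
  proof -
    have "h * g = h * (g * ?U) * V"
      using gc hc Vc by (simp add: assoc_mult_mat[of _ "4 ^ n" "4 ^ n" _ "4 ^ n" _ "4 ^ n"] mult_carrier_mat[of _ "4 ^ n" "4 ^ n" _ "4 ^ n"])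
    also have "\<dots> = c \<cdot>\<^sub>m V"
      unfolding h(2) using Vc by (simp add: mult_smult_assoc_mat[of _ "4 ^ n" "4 ^ n" _ "4 ^ n"])
    finally show ?thesis .
  qed
  \<comment> \<open>The commutant argument yields some scalar \<open>c\<close> only; that it has
    modulus 1 comes from the unitarity of the reduced operator.\<close>
  have "c \<cdot>\<^sub>m 1\<^sub>m (4 ^ n) \<in> unitaries (4 ^ n)"
    using unitaries_mult[OF gate_products_unitary[OF h(1)] unitaries_mult[OF gate_products_unitary[OF g(1)] U]]
    by (simp only: h(2))
  then have "(c \<cdot>\<^sub>m 1\<^sub>m (4 ^ n)) * (cnj c \<cdot>\<^sub>m 1\<^sub>m (4 ^ n)) = 1\<^sub>m (4 ^ n)"
    by (simp add: unitaries_iff mat_adjoint_smult mat_adjoint_one)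
  then have "(c * cnj c) \<cdot>\<^sub>m 1\<^sub>m (4 ^ n) = 1 \<cdot>\<^sub>m (1\<^sub>m (4 ^ n) :: complex mat)"
    by (simp add: smult_mult_smult[of _ "4 ^ n" "4 ^ n" _ "4 ^ n"])
  then have "c * cnj c = 1"
    by (rule unitaries_scalar_eq[OF _ unitaries_one]) simp
  then have "complex_of_real ((cmod c)\<^sup>2) = 1" by (simp only: complex_norm_square)
  then have "(cmod c)\<^sup>2 = 1" by (simp only: of_real_eq_1_iff)
  then have "cmod c = 1" by (simp add: abs_square_eq_1)
  then have "V \<simeq> h * g" by (rule phase_eq_sym[OF phase_eqI[OF _ hg]])
  then show ?thesis by (rule gate_products_phase[OF _ gate_products_mult[OF h(1) g(1)]])
qed

section \<open>From the normalizer condition to the action on vectors\<close>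

lemma pauli_group_unitary: "pauli_group n \<subseteq> unitaries (4 ^ n)"
  unfolding pauli_group_def
proof (rule group.generate_incl[OF group_unitary_group])
  show "(\<lambda>i. on_factor n i X_gate) ` {1..n} \<union> (\<lambda>i. on_factor n i Z_gate) ` {1..n}
      \<union> {sqrt_i \<cdot>\<^sub>m 1\<^sub>m (4 ^ n)} \<subseteq> unitaries (4 ^ n)"
    by (auto simp flip: pauli1_X pauli1_Z intro!: unitaries_on_factor unitaries_pauli1
      unitaries_smult unitaries_one)
qed

lemma inv_unitary_group: "U \<in> unitaries N \<Longrightarrow> inv\<^bsub>unitary_group N\<^esub> U = mat_adjoint U"
  by (rule group.inv_equality[OF group_unitary_group]) (auto simp: unitaries_iff mat_adjoint_adjoint)

text \<open>The generators have the form of a phase times some \<open>pauli n v\<close>, and this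
  form is stable under products and adjoints, hence holds on the generated group.\<close>

lemma pauli_group_phase_eq: "h \<in> pauli_group n \<Longrightarrow> \<exists>v. h \<simeq> pauli n v"
proof -
  let ?H = "(\<lambda>i. on_factor n i X_gate) ` {1..n} \<union> (\<lambda>i. on_factor n i Z_gate) ` {1..n}
       \<union> {sqrt_i \<cdot>\<^sub>m 1\<^sub>m (4 ^ n)}"
  have gen: "\<exists>v. h \<simeq> pauli n v" if "h \<in> ?H" for h
  proof -
    from that consider i where "1 \<le> i" "i \<le> n" "h = on_factor n i X_gate"
      | i where "1 \<le> i" "i \<le> n" "h = on_factor n i Z_gate" | "h = sqrt_i \<cdot>\<^sub>m 1\<^sub>m (4 ^ n)" by auto
    then show ?thesis
    proof cases
      case (1 i)
      then show ?thesis by (intro exI[of _ "single i (1, 0)"]) (simp add: pauli_single pauli1_X)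
    next
      case (2 i)
      then show ?thesis by (intro exI[of _ "single i (0, 1)"]) (simp add: pauli_single pauli1_Z)
    next
      case 3
      then show ?thesis
        by (intro exI[of _ "\<lambda>_. 0"] phase_eqI[of sqrt_i]) (simp_all add: pauli_zero)
    qed
  qed
  have H: "?H \<subseteq> unitaries (4 ^ n)"
    using pauli_group_unitary[of n] generate.incl[of _ ?H "unitary_group (4 ^ n)"]
    unfolding pauli_group_def by blast
  assume "h \<in> pauli_group n"
  then have "h \<in> generate (unitary_group (4 ^ n)) ?H" by (simp add: pauli_group_def)
  then show ?thesis
  proof (induction rule: generate.induct)
    case one
    show ?case by (intro exI[of _ "\<lambda>_. 0"]) (simp add: pauli_zero)
  next
    case (incl h)
    then show ?case by (rule gen)
  next
    case (inv h)
    then obtain v where "h \<simeq> pauli n v" using gen by blast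
    from phase_eq_trans[OF phase_eq_adjoint[OF this] mat_adjoint_pauli]
    have "mat_adjoint h \<simeq> pauli n (\<lambda>i. - v i)" .
    moreover have "h \<in> unitaries (4 ^ n)" using inv H by blast
    ultimately show ?case by (auto simp: inv_unitary_group)
  next
    case (eng a b)
    then obtain v w where "a \<simeq> pauli n v" "b \<simeq> pauli n w" by blast
    then have "a * b \<simeq> pauli n v * pauli n w" by (rule phase_eq_mult) auto
    also have "\<dots> \<simeq> pauli n (\<lambda>i. v i + w i)" by (rule phase_eqI[OF _ pauli_mult]) simp
    finally show ?case by auto
  qed
qed

lemma pauli_single_in_pauli_group:
  "pauli n (single i p) \<in> pauli_group n" if "1 \<le> i" "i \<le> n" "p \<in> {(1, 0), (0, 1)}"
  using that unfolding pauli_group_def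
  by (auto simp: pauli_single pauli1_X pauli1_Z intro!: generate.incl)

lemma clifford_group_conj:
  assumes "V \<in> clifford_group n"
  shows "V \<in> unitaries (4 ^ n)" "p \<in> pauli_group n \<Longrightarrow> mat_adjoint V * p * V \<in> pauli_group n"
proof -
  let ?G = "unitary_group (4 ^ n)"
  show V: "V \<in> unitaries (4 ^ n)"
    using assms by (simp add: clifford_group_def normalizer_def stabilizer_def)
  \<comment> \<open>The action defining the normalizer is restricted to subsets of the carrier, so
    \<open>pauli_group_unitary\<close> is what allows it to be evaluated.\<close>
  have conj: "V <#\<^bsub>?G\<^esub> pauli_group n #>\<^bsub>?G\<^esub> inv\<^bsub>?G\<^esub> V = pauli_group n"
    using assms pauli_group_unitary[of n] by (simp add: clifford_group_def normalizer_def stabilizer_def)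
  have Vc: "V \<in> carrier_mat (4 ^ n) (4 ^ n)" "mat_adjoint V \<in> carrier_mat (4 ^ n) (4 ^ n)"
    "mat_adjoint V * V = 1\<^sub>m (4 ^ n)"
    using V by (auto simp: unitaries_iff)
  assume "p \<in> pauli_group n"
  \<comment> \<open>The normalizer condition is an equality of sets. Its surjective half, that every
    Pauli element is a conjugate of one, turns conjugation by \<open>V\<close> into conjugation by
    its inverse.\<close>
  then obtain q where q: "q \<in> pauli_group n" "p = V * q * mat_adjoint V"
    using conj by (auto simp: l_coset_def r_coset_def inv_unitary_group[OF V])
  have qc: "q \<in> carrier_mat (4 ^ n) (4 ^ n)" using q(1) pauli_group_unitary[of n] by auto
  have "mat_adjoint V * p * V = (mat_adjoint V * V) * q * (mat_adjoint V * V)"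
    unfolding q(2) using Vc(1,2) qc
    by (simp add: assoc_mult_mat[of _ "4 ^ n" "4 ^ n" _ "4 ^ n" _ "4 ^ n"] mult_carrier_mat[of _ "4 ^ n" "4 ^ n" _ "4 ^ n"])
  also have "\<dots> = q" unfolding Vc(3) using qc by simp
  finally show "mat_adjoint V * p * V \<in> pauli_group n" using q(1) by simp
qed

lemma clifford_group_preserves_pauli:
  assumes "V \<in> clifford_group n"
  shows "preserves_pauli n (mat_adjoint V)"
  unfolding preserves_pauli_def
proof (intro allI impI)
  fix j p assume jp: "1 \<le> j \<and> j \<le> n \<and> p \<in> {(1 :: z4, 0 :: z4), (0, 1)}"
  let ?P = "pauli n (single j p)" and ?U = "mat_adjoint V"
  have V: "V \<in> carrier_mat (4 ^ n) (4 ^ n)" "?U \<in> carrier_mat (4 ^ n) (4 ^ n)" "V * ?U = 1\<^sub>m (4 ^ n)"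
    using clifford_group_conj(1)[OF assms] by (auto simp: unitaries_iff)
  have "?P \<in> pauli_group n" using jp by (intro pauli_single_in_pauli_group) auto
  then obtain w where w: "?U * ?P * V \<simeq> pauli n w"
    using pauli_group_phase_eq[OF clifford_group_conj(2)[OF assms]] by blast
  have "?U * ?P = ?U * ?P * (V * ?U)" unfolding V(3) using V by simp
  also have "\<dots> = (?U * ?P * V) * ?U"
    using V(1,2) by (simp add: assoc_mult_mat[of _ "4 ^ n" "4 ^ n" _ "4 ^ n" _ "4 ^ n"] mult_carrier_mat[of _ "4 ^ n" "4 ^ n" _ "4 ^ n"])
  also have "\<dots> \<simeq> pauli n w * ?U"
    by (rule phase_eq_mult[OF w phase_eq_refl pauli_carrier V(2)])
  finally show "\<exists>w. maps_pauli n ?U (single j p) w" unfolding maps_pauli_def by blast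
qed

theorem theorem1:
  fixes n :: nat and V :: "complex mat"
  assumes "n \<ge> 1"
    and "V \<in> clifford_group n"
  shows "\<exists>(c :: complex) (gs :: complex mat list).
           cmod c = 1 \<and> set gs \<subseteq> elementary_gates n \<and>
           V = c \<cdot>\<^sub>m foldr (*) gs (1\<^sub>m (4 ^ n))"
proof -
  have "V \<in> gate_products n"
    by (rule preserves_pauli_adjoint_gate_product[OF clifford_group_conj(1)[OF assms(2)]
      clifford_group_preserves_pauli[OF assms(2)]])
  then show ?thesis unfolding gate_products_def by blast
qed

end
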